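(* Let $B=A^{\mathrm{co}H}\subseteq A$ be a Hopf–Galois extension for a Hopf algebra $H$, with $A$ faithfully flat as a right $B$-module, and with both $H$ and $A$ endowed with a bi-grading of $\mathbb{Z}^n$ satisfying the conditions listed in the context ($B$ carrying the bi-grading inherited from $A$). Let $\theta$ be a real skew-symmetric $n\times n$ matrix and let $(H_\Theta,A_\Theta)$ be the corresponding deformed pair, with coinvariant subalgebra $B_\Theta$. Define a deformed canonical Galois map $\chi_\Theta$ by $$\chi_\Theta:A_\Theta\otimes_{B_\Theta}A_\Theta\to A_\Theta\otimes H_\Theta,\qquad a'\otimes_{B_\Theta}a\mapsto a'\cdot_\Theta a_{(0)}\otimes a_{(1)}.$$ Then $\chi_\Theta$ is invertible if and only if the starting canonical Galois map $\chi:A\otimes_BA\to A\otimes H$ is, with the same translation map, but viewed as a map $\tau:H_\Theta\to A_\Theta\otimes_{B_\Theta}A_\Theta$.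
   Context: All algebras are unital associative over $\mathbb{C}$ and $\otimes=\otimes_{\mathbb{C}}$. Hopf–Galois extension: let $A$ be a right $H$-comodule algebra with coaction $\delta^A:A\to A\otimes H$, $\delta^A(a)=a_{(0)}\otimes a_{(1)}$, and let $B=A^{\mathrm{co}H}=\{b\in A:\delta^A(b)=b\otimes1_H\}$. The extension $B\subseteq A$ is Hopf–Galois if the canonical Galois map $\chi:A\otimes_BA\to A\otimes H$, $a'\otimes_Ba\mapsto a'a_{(0)}\otimes a_{(1)}$, is an isomorphism. Its translation map is $\tau:H\to A\otimes_BA$, $\tau(h)=\chi^{-1}(1_A\otimes h)$; the translation map of $\chi_\Theta$ is defined in the same way from $\chi_\Theta^{-1}$. Conditions on the bi-grading of the Hopf algebra $H=\bigoplus_{r,s\in\mathbb{Z}^n}H_{(r,s)}$: (i) $H_{(r,s)}\cdot H_{(p,q)}\subset H_{(r+p,s+q)}$; (ii) $\Delta(H_{(r,l)})\subset\bigoplus_{s\in\mathbb{Z}^n}H_{(r,s)}\otimes H_{(s,l)}$; (iii) $\varepsilon(h)=0$ for $h\in H_{(r,l)}$ with $r\ne l$; (iv) the antipode satisfies $S(H_{(r,l)})\subset H_{(-l,-r)}$ and, if $H$ has a $*$-structure, $(H_{(r,l)})^*\subset H_{(-r,-l)}$. Conditions on the bi-grading of the comodule algebra $A=\bigoplus_{r,s\in\mathbb{Z}^n}A_{(r,s)}$: $A_{(r,s)}A_{(p,q)}\subset A_{(r+p,s+q)}$ and $\delta^A(A_{(r,l)})\subset\bigoplus_{s\in\mathbb{Z}^n}A_{(r,s)}\otimes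 H_{(s,l)}$. Deformation: let $\lambda_\theta(r,l)=e^{\pi i\langle\theta r,l\rangle}$ for $r,l\in\mathbb{Z}^n$, with $\langle\cdot,\cdot\rangle$ the standard pairing, and $\Theta=\begin{pmatrix}\theta&0\\0&-\theta\end{pmatrix}$. On $H$ and on $A$ the deformed product of homogeneous elements $x,y$ of bi-degrees $(r_1,r_2)$ and $(l_1,l_2)$ is $x\cdot_\Theta y=\lambda_\theta(r_1,l_1)\,\lambda_{-\theta}(r_2,l_2)\,xy$, extended bilinearly. Then $H_\Theta=(H,\cdot_\Theta)$ is a Hopf algebra with the same coproduct, counit and antipode as $H$; $A_\Theta=(A,\cdot_\Theta)$ is an $H_\Theta$-comodule algebra with the same coaction, viewed as a map $A_\Theta\to A_\Theta\otimes H_\Theta$; and its coinvariant subalgebra is $B_\Theta=A_\Theta^{\mathrm{co}H_\Theta}=(B,\cdot_\Theta)$. As vector spaces, $H_\Theta=H$, $A_\Theta=A$ and $B_\Theta=B$. *)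

theory Defs
  imports "HOL-Analysis.Analysis" "HOL-Library.Poly_Mapping"
begin

section \<open>Complex vector spaces\<close>

class complex_vector = ab_group_add +
  fixes scaleC :: "complex \<Rightarrow> 'a \<Rightarrow> 'a"  (infixr \<open>*\<^sub>C\<close> 75)
  assumes scaleC_add_right: "c *\<^sub>C (x + y) = c *\<^sub>C x + c *\<^sub>C y"
    and scaleC_add_left: "(c + d) *\<^sub>C x = c *\<^sub>C x + d *\<^sub>C x"
    and scaleC_scaleC: "c *\<^sub>C d *\<^sub>C x = (c * d) *\<^sub>C x"
    and scaleC_one: "1 *\<^sub>C x = x"

global_interpretation complex_vector:
  vector_space "scaleC :: complex \<Rightarrow> 'a \<Rightarrow> 'a::complex_vector"
  by unfold_locales (simp_all add: scaleC_add_right scaleC_add_left scaleC_scaleC scaleC_one)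

abbreviation clinear :: "('a::complex_vector \<Rightarrow> 'b::complex_vector) \<Rightarrow> bool" where
  "clinear \<equiv> Vector_Spaces.linear scaleC scaleC"

abbreviation cspan :: "'a::complex_vector set \<Rightarrow> 'a set" where
  "cspan \<equiv> complex_vector.span"

abbreviation csubspace :: "'a::complex_vector set \<Rightarrow> bool" where
  "csubspace \<equiv> complex_vector.subspace"

definition cbilinear :: "('a::complex_vector \<Rightarrow> 'b::complex_vector \<Rightarrow> 'c::complex_vector) \<Rightarrow> bool" where
  "cbilinear \<phi> \<longleftrightarrow> (\<forall>y. clinear (\<lambda>x. \<phi> x y)) \<and> (\<forall>x. clinear (\<phi> x))"

lemma clinearI:
  assumes "\<And>x y. f (x + y) = f x + f y" "\<And>c x. f (c *\<^sub>C x) = c *\<^sub>C f x"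
  shows "clinear f"
  using assms by unfold_locales auto

lemma clinear_add: "clinear f \<Longrightarrow> f (x + y) = f x + f y"
  and clinear_scale: "clinear f \<Longrightarrow> f (c *\<^sub>C x) = c *\<^sub>C f x"
  by (simp_all add: Vector_Spaces.linear_iff_module_hom module_hom.add module_hom.scale)

lemma clinear_zero: "clinear f \<Longrightarrow> f 0 = 0"
  using clinear_scale[of f 0 0] by simp

lemma clinear_diff: "clinear f \<Longrightarrow> f (x - y) = f x - f y"
  using clinear_add[of f "x - y" y] by simp

instantiation complex :: complex_vector
begin
definition scaleC_complex :: "complex \<Rightarrow> complex \<Rightarrow> complex" where
  "scaleC_complex c z = c * z"
instance
  by standard (simp_all add: scaleC_complex_def algebra_simps)
end

instantiation poly_mapping :: (type, complex_vector) complex_vector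
begin
definition scaleC_poly_mapping :: "complex \<Rightarrow> ('a \<Rightarrow>\<^sub>0 'b) \<Rightarrow> ('a \<Rightarrow>\<^sub>0 'b)" where
  "scaleC_poly_mapping c p = Poly_Mapping.map (scaleC c) p"

lemma lookup_scaleC: "Poly_Mapping.lookup (c *\<^sub>C p) k = c *\<^sub>C Poly_Mapping.lookup p k"
  by (simp add: scaleC_poly_mapping_def map.rep_eq when_def)

instance
  by standard
    (auto intro!: poly_mapping_eqI
      simp: lookup_scaleC lookup_add scaleC_add_right scaleC_add_left scaleC_scaleC scaleC_one)
end


section \<open>Tensor products over the complex numbers\<close>

text \<open>The free complex vector space on \<open>'a \<times> 'b\<close> is \<open>'a \<times> 'b \<Rightarrow>\<^sub>0 complex\<close>.\<close>

abbreviation pure :: "'a \<Rightarrow> 'b \<Rightarrow> ('a \<times> 'b \<Rightarrow>\<^sub>0 complex)" where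
  "pure x y \<equiv> Poly_Mapping.single (x, y) 1"

definition tensor_null :: "('a::complex_vector \<times> 'b::complex_vector \<Rightarrow>\<^sub>0 complex) set" where
  "tensor_null = cspan
    ({pure (x + x') y - pure x y - pure x' y |x x' y. True} \<union>
     {pure x (y + y') - pure x y - pure x y' |x y y'. True} \<union>
     {pure (c *\<^sub>C x) y - c *\<^sub>C pure x y |c x y. True} \<union>
     {pure x (c *\<^sub>C y) - c *\<^sub>C pure x y |c x y. True})"

definition tensor_rel ::
  "('a::complex_vector \<times> 'b::complex_vector \<Rightarrow>\<^sub>0 complex) \<Rightarrow> ('a \<times> 'b \<Rightarrow>\<^sub>0 complex) \<Rightarrow> bool" where
  "tensor_rel p q \<longleftrightarrow> p - q \<in> tensor_null"

lemma subspace_tensor_null: "csubspace tensor_null"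
  unfolding tensor_null_def by simp

lemma equivp_tensor_rel: "equivp tensor_rel"
proof (rule equivpI)
  show "reflp tensor_rel"
    unfolding reflp_def tensor_rel_def
    using complex_vector.subspace_0[OF subspace_tensor_null] by simp
  show "symp tensor_rel"
    unfolding symp_def tensor_rel_def
    using complex_vector.subspace_neg[OF subspace_tensor_null] by fastforce
  show "transp tensor_rel"
    unfolding transp_def tensor_rel_def
    using complex_vector.subspace_add[OF subspace_tensor_null] by fastforce
qed

quotient_type (overloaded) ('a, 'b) tensor =
  "('a::complex_vector \<times> 'b::complex_vector) \<Rightarrow>\<^sub>0 complex" / tensor_rel
  by (rule equivp_tensor_rel)

instantiation tensor :: (complex_vector, complex_vector) complex_vector
begin

lift_definition zero_tensor :: "('a, 'b) tensor" is 0 .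

lift_definition plus_tensor :: "('a, 'b) tensor \<Rightarrow> ('a, 'b) tensor \<Rightarrow> ('a, 'b) tensor" is "(+)"
  using complex_vector.subspace_add[OF subspace_tensor_null]
  unfolding tensor_rel_def add_diff_add by blast

lift_definition uminus_tensor :: "('a, 'b) tensor \<Rightarrow> ('a, 'b) tensor" is uminus
  using complex_vector.subspace_neg[OF subspace_tensor_null]
  unfolding tensor_rel_def minus_diff_minus by blast

lift_definition minus_tensor :: "('a, 'b) tensor \<Rightarrow> ('a, 'b) tensor \<Rightarrow> ('a, 'b) tensor" is "(-)"
proof -
  fix p p' q q' :: "'a \<times> 'b \<Rightarrow>\<^sub>0 complex"
  assume "tensor_rel p p'" "tensor_rel q q'"
  then have "(p - p') - (q - q') \<in> tensor_null"
    unfolding tensor_rel_def by (rule complex_vector.subspace_diff[OF subspace_tensor_null])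
  then show "tensor_rel (p - q) (p' - q')"
    unfolding tensor_rel_def by (simp add: algebra_simps)
qed

lift_definition scaleC_tensor :: "complex \<Rightarrow> ('a, 'b) tensor \<Rightarrow> ('a, 'b) tensor" is scaleC
  using complex_vector.subspace_scale[OF subspace_tensor_null]
  unfolding tensor_rel_def complex_vector.scale_right_diff_distrib[symmetric] by blast

instance
proof -
  have refl: "tensor_rel p p" for p :: "'a \<times> 'b \<Rightarrow>\<^sub>0 complex"
    using equivp_tensor_rel by (rule equivp_reflp)
  show "OFCLASS(('a, 'b) tensor, complex_vector_class)"
    by (standard; transfer)
      (simp_all add: refl algebra_simps scaleC_add_right scaleC_add_left scaleC_scaleC scaleC_one)
qed

end

lift_definition tensor :: "'a::complex_vector \<Rightarrow> 'b::complex_vector \<Rightarrow> ('a, 'b) tensor"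
  (infixr \<open>\<otimes>\<close> 76) is pure .

lemma tensor_null_gens:
  "pure (x + x') y - (pure x y + pure x' y) \<in> tensor_null"
  "pure x (y + y') - (pure x y + pure x y') \<in> tensor_null"
  "pure (c *\<^sub>C x) y - c *\<^sub>C pure x y \<in> tensor_null"
  "pure x (c *\<^sub>C y) - c *\<^sub>C pure x y \<in> tensor_null"
  unfolding tensor_null_def diff_diff_eq[symmetric]
  by (rule complex_vector.span_base; blast)+

lemma tensor_bilinear: "cbilinear (\<otimes>)"
proof -
  have a: "(x + x') \<otimes> y = x \<otimes> y + x' \<otimes> y" for x x' :: 'a and y :: 'b
    by transfer (simp only: tensor_rel_def tensor_null_gens)
  have b: "x \<otimes> (y + y') = x \<otimes> y + x \<otimes> y'" for x :: 'a and y y' :: 'b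
    by transfer (simp only: tensor_rel_def tensor_null_gens)
  have c: "(c *\<^sub>C x) \<otimes> y = c *\<^sub>C (x \<otimes> y)" for c and x :: 'a and y :: 'b
    by transfer (simp only: tensor_rel_def tensor_null_gens)
  have d: "x \<otimes> (c *\<^sub>C y) = c *\<^sub>C (x \<otimes> y)" for c and x :: 'a and y :: 'b
    by transfer (simp only: tensor_rel_def tensor_null_gens)
  show ?thesis
    unfolding cbilinear_def by (auto intro!: clinearI simp: a b c d)
qed

definition free_lift ::
  "('a \<Rightarrow> 'b \<Rightarrow> 'c::complex_vector) \<Rightarrow> ('a \<times> 'b \<Rightarrow>\<^sub>0 complex) \<Rightarrow> 'c" where
  "free_lift \<phi> p = (\<Sum>(x, y)\<in>Poly_Mapping.keys p. Poly_Mapping.lookup p (x, y) *\<^sub>C \<phi> x y)"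

text \<open>The linear map on the tensor product induced by \<open>\<phi>\<close>; it is meaningful for bilinear
  \<open>\<phi>\<close> only, and then independent of the representative (\<open>tensor_lift_tensor\<close>,
  \<open>clinear_tensor_lift\<close>, \<open>tensor_lift_unique\<close>).\<close>

definition tensor_lift ::
  "('a::complex_vector \<Rightarrow> 'b::complex_vector \<Rightarrow> 'c::complex_vector) \<Rightarrow> ('a, 'b) tensor \<Rightarrow> 'c" where
  "tensor_lift \<phi> t = free_lift \<phi> (rep_tensor t)"

lemma free_lift_superset:
  assumes "finite S" "Poly_Mapping.keys p \<subseteq> S"
  shows "free_lift \<phi> p = (\<Sum>k\<in>S. Poly_Mapping.lookup p k *\<^sub>C \<phi> (fst k) (snd k))"
  unfolding free_lift_def case_prod_beta
  by (rule sum.mono_neutral_cong_left)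
    (use assms in \<open>auto simp: in_keys_iff\<close>)

lemma clinear_free_lift: "clinear (free_lift \<phi>)"
proof (rule clinearI)
  fix p q :: "'a \<times> 'b \<Rightarrow>\<^sub>0 complex" and c
  let ?S = "Poly_Mapping.keys p \<union> Poly_Mapping.keys q"
  have "Poly_Mapping.keys (p + q) \<subseteq> ?S"
    by (rule Poly_Mapping.keys_add)
  then show "free_lift \<phi> (p + q) = free_lift \<phi> p + free_lift \<phi> q"
    by (simp add: free_lift_superset[of ?S] lookup_add scaleC_add_left sum.distrib)
  have "Poly_Mapping.keys (c *\<^sub>C p) \<subseteq> Poly_Mapping.keys p"
    by (auto simp: in_keys_iff lookup_scaleC)
  then show "free_lift \<phi> (c *\<^sub>C p) = c *\<^sub>C free_lift \<phi> p"
    by (simp add: free_lift_superset[of "Poly_Mapping.keys p"] lookup_scaleC scaleC_complex_def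
        complex_vector.scale_sum_right scaleC_scaleC)
qed

lemma free_lift_pure: "free_lift \<phi> (pure x y) = \<phi> x y"
  by (simp add: free_lift_def scaleC_one)

lemma free_lift_null:
  assumes "cbilinear \<phi>" and "p \<in> tensor_null"
  shows "free_lift \<phi> p = 0"
proof -
  note L = clinear_free_lift[of \<phi>]
  have l: "clinear (\<lambda>x. \<phi> x y)" and r: "clinear (\<phi> x)" for x y
    using assms(1) by (auto simp: cbilinear_def)
  have "csubspace {q. free_lift \<phi> q = 0}"
    unfolding complex_vector.subspace_def
    by (simp add: clinear_zero[OF L] clinear_add[OF L] clinear_scale[OF L])
  with assms(2) show ?thesis
    unfolding tensor_null_def
    by (rule complex_vector.span_induct)
      (auto simp: clinear_diff[OF L] clinear_scale[OF L] free_lift_pure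
        clinear_add[OF l] clinear_add[OF r] clinear_scale[OF l] clinear_scale[OF r])
qed

lemma ex_abs_tensor: "\<exists>p. t = abs_tensor p"
  using Quotient3_abs_rep[OF Quotient3_tensor] by metis

lemma tensor_lift_abs:
  assumes "cbilinear \<phi>"
  shows "tensor_lift \<phi> (abs_tensor p) = free_lift \<phi> p"
proof -
  have "tensor_rel (rep_tensor (abs_tensor p)) p"
    using Quotient3_rep_abs[OF Quotient3_tensor] equivp_reflp[OF equivp_tensor_rel] by blast
  then show ?thesis
    using free_lift_null[OF assms] clinear_diff[OF clinear_free_lift]
    unfolding tensor_rel_def tensor_lift_def by (metis eq_iff_diff_eq_0)
qed

lemma tensor_lift_tensor: "cbilinear \<phi> \<Longrightarrow> tensor_lift \<phi> (x \<otimes> y) = \<phi> x y"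
  by (simp add: tensor.abs_eq tensor_lift_abs free_lift_pure)

lemma clinear_tensor_lift:
  assumes "cbilinear \<phi>"
  shows "clinear (tensor_lift \<phi>)"
proof (rule clinearI)
  show "tensor_lift \<phi> (s + t) = tensor_lift \<phi> s + tensor_lift \<phi> t" for s t
  proof -
    obtain p q where "s = abs_tensor p" "t = abs_tensor q"
      using ex_abs_tensor by metis
    then show ?thesis
      by (simp add: plus_tensor.abs_eq tensor_lift_abs[OF assms] clinear_add[OF clinear_free_lift])
  qed
  show "tensor_lift \<phi> (c *\<^sub>C t) = c *\<^sub>C tensor_lift \<phi> t" for c t
  proof -
    obtain p where "t = abs_tensor p"
      using ex_abs_tensor by metis
    then show ?thesis
      by (simp add: scaleC_tensor.abs_eq tensor_lift_abs[OF assms] clinear_scale[OF clinear_free_lift])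
  qed
qed

lemma tensor_span: "t \<in> cspan {x \<otimes> y |x y. True}"
proof -
  have single: "abs_tensor (Poly_Mapping.single (x, y) c) = c *\<^sub>C (x \<otimes> y)"
    for x :: 'a and y :: 'b and c
  proof -
    have "Poly_Mapping.single (x, y) c = c *\<^sub>C pure x y"
      by (rule poly_mapping_eqI) (simp add: lookup_scaleC lookup_single when_def scaleC_complex_def)
    then show ?thesis
      by (simp add: tensor.abs_eq scaleC_tensor.abs_eq)
  qed
  have sum: "abs_tensor (\<Sum>k\<in>K. Poly_Mapping.single k (f k)) \<in> cspan {x \<otimes> y |x y. True}"
    if "finite K" for K and f :: "'a \<times> 'b \<Rightarrow> complex"
    using that
  proof (induction K rule: finite_induct)
    case empty
    then show ?case
      by (simp only: sum.empty zero_tensor.abs_eq[symmetric] complex_vector.span_zero)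
  next
    case (insert k K)
    obtain x y where k: "k = (x, y)" by fastforce
    have "abs_tensor (Poly_Mapping.single k (f k)) \<in> cspan {x \<otimes> y |x y. True}"
      unfolding k single by (intro complex_vector.span_scale complex_vector.span_base) blast
    from complex_vector.span_add[OF this insert.IH] show ?case
      by (simp only: sum.insert[OF insert.hyps] plus_tensor.abs_eq)
  qed
  obtain p where t: "t = abs_tensor p"
    using ex_abs_tensor by metis
  have "p = (\<Sum>k\<in>Poly_Mapping.keys p. Poly_Mapping.single k (Poly_Mapping.lookup p k))"
  proof (rule poly_mapping_eqI)
    fix j
    have "Poly_Mapping.lookup
        (\<Sum>k\<in>Poly_Mapping.keys p. Poly_Mapping.single k (Poly_Mapping.lookup p k)) j =
        (\<Sum>k\<in>Poly_Mapping.keys p. if k = j then Poly_Mapping.lookup p k else 0)"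
      by (simp add: lookup_sum lookup_single when_def)
    also have "\<dots> = Poly_Mapping.lookup p j"
      by (simp add: in_keys_iff)
    finally show "Poly_Mapping.lookup p j = Poly_Mapping.lookup
        (\<Sum>k\<in>Poly_Mapping.keys p. Poly_Mapping.single k (Poly_Mapping.lookup p k)) j"
      by (rule sym)
  qed
  then have "t = abs_tensor (\<Sum>k\<in>Poly_Mapping.keys p. Poly_Mapping.single k (Poly_Mapping.lookup p k))"
    using t by (rule_tac trans[OF t arg_cong[where f = abs_tensor]])
  then show ?thesis
    using sum[OF finite_keys] by (rule ssubst)
qed

lemma tensor_eqI:
  assumes "clinear F" "clinear G" "\<And>x y. F (x \<otimes> y) = G (x \<otimes> y)"
  shows "F t = G t"
proof -
  have "csubspace {u. F u = G u}"
    unfolding complex_vector.subspace_def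
    by (simp add: clinear_zero[OF assms(1)] clinear_add[OF assms(1)] clinear_scale[OF assms(1)]
        clinear_zero[OF assms(2)] clinear_add[OF assms(2)] clinear_scale[OF assms(2)])
  with tensor_span show ?thesis
    by (rule complex_vector.span_induct) (use assms(3) in auto)
qed

lemma tensor_lift_unique:
  assumes "cbilinear \<phi>" "clinear F" "\<And>x y. F (x \<otimes> y) = \<phi> x y"
  shows "F = tensor_lift \<phi>"
  by (rule ext, rule tensor_eqI) (simp_all add: assms clinear_tensor_lift tensor_lift_tensor)

definition tensor_map ::
  "('a::complex_vector \<Rightarrow> 'c::complex_vector) \<Rightarrow> ('b::complex_vector \<Rightarrow> 'd::complex_vector)
    \<Rightarrow> ('a, 'b) tensor \<Rightarrow> ('c, 'd) tensor" where
  "tensor_map f g = tensor_lift (\<lambda>x y. f x \<otimes> g y)"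

definition tensor_assoc ::
  "(('a::complex_vector, 'b::complex_vector) tensor, 'c::complex_vector) tensor
    \<Rightarrow> ('a, ('b, 'c) tensor) tensor" where
  "tensor_assoc = tensor_lift (\<lambda>t z. tensor_lift (\<lambda>x y. x \<otimes> y \<otimes> z) t)"


section \<open>Algebras, Hopf algebras and comodule algebras\<close>

record 'a alg =
  alg_mult :: "'a \<Rightarrow> 'a \<Rightarrow> 'a"
  alg_one :: 'a

record (overloaded) ('h::complex_vector) hopf_alg = "'h alg" +
  comult :: "'h \<Rightarrow> ('h, 'h) tensor"
  counit :: "'h \<Rightarrow> complex"
  antipode :: "'h \<Rightarrow> 'h"

record (overloaded) ('a::complex_vector, 'h::complex_vector) comod_alg = "'a alg" +
  coact :: "'a \<Rightarrow> ('a, 'h) tensor"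

locale complex_algebra =
  fixes A :: "('a::complex_vector, 'z) alg_scheme"
  assumes mult_bilinear: "cbilinear (alg_mult A)"
    and mult_assoc: "alg_mult A (alg_mult A x y) z = alg_mult A x (alg_mult A y z)"
    and mult_one_left: "alg_mult A (alg_one A) x = x"
    and mult_one_right: "alg_mult A x (alg_one A) = x"

definition tensor_mult ::
  "('a::complex_vector, 'y) alg_scheme \<Rightarrow> ('b::complex_vector, 'z) alg_scheme
    \<Rightarrow> ('a, 'b) tensor \<Rightarrow> ('a, 'b) tensor \<Rightarrow> ('a, 'b) tensor" where
  "tensor_mult A B s t =
    tensor_lift (\<lambda>x y. tensor_lift (\<lambda>x' y'. alg_mult A x x' \<otimes> alg_mult B y y') t) s"

locale hopf_algebra = complex_algebra H
  for H :: "'h::complex_vector hopf_alg" +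
  assumes comult_linear: "clinear (comult H)"
    and comult_mult: "comult H (alg_mult H x y) = tensor_mult H H (comult H x) (comult H y)"
    and comult_one: "comult H (alg_one H) = alg_one H \<otimes> alg_one H"
    and coassoc: "tensor_assoc (tensor_map (comult H) id (comult H x)) =
      tensor_map id (comult H) (comult H x)"
    and counit_linear: "clinear (counit H)"
    and counit_mult: "counit H (alg_mult H x y) = counit H x * counit H y"
    and counit_one: "counit H (alg_one H) = 1"
    and counit_left: "tensor_lift (\<lambda>y z. counit H y *\<^sub>C z) (comult H x) = x"
    and counit_right: "tensor_lift (\<lambda>y z. counit H z *\<^sub>C y) (comult H x) = x"
    and antipode_linear: "clinear (antipode H)"
    and antipode_left: "tensor_lift (\<lambda>y z. alg_mult H (antipode H y) z) (comult H x) =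
      counit H x *\<^sub>C alg_one H"
    and antipode_right: "tensor_lift (\<lambda>y z. alg_mult H y (antipode H z)) (comult H x) =
      counit H x *\<^sub>C alg_one H"

text \<open>Compatibility of the antilinear map \<open>* \<otimes> *\<close> with the coproduct is expressed through finite
  expansions, since \<open>tensor_lift\<close> only provides linear maps.\<close>

locale hopf_star =
  fixes H :: "'h::complex_vector hopf_alg" and star :: "'h \<Rightarrow> 'h"
  assumes star_add: "star (x + y) = star x + star y"
    and star_scale: "star (c *\<^sub>C x) = cnj c *\<^sub>C star x"
    and star_star: "star (star x) = x"
    and star_mult: "star (alg_mult H x y) = alg_mult H (star y) (star x)"
    and star_comult: "comult H x = (\<Sum>(y, z)\<leftarrow>yzs. y \<otimes> z) \<Longrightarrow>
      comult H (star x) = (\<Sum>(y, z)\<leftarrow>yzs. star y \<otimes> star z)"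
    and star_counit: "counit H (star x) = cnj (counit H x)"

locale comodule_algebra = hopf_algebra H + A: complex_algebra A
  for H :: "'h::complex_vector hopf_alg"
    and A :: "('a::complex_vector, 'h) comod_alg" +
  assumes coact_linear: "clinear (coact A)"
    and coact_mult: "coact A (alg_mult A x y) = tensor_mult A H (coact A x) (coact A y)"
    and coact_one: "coact A (alg_one A) = alg_one A \<otimes> alg_one H"
    and coact_coassoc: "tensor_assoc (tensor_map (coact A) id (coact A x)) =
      tensor_map id (comult H) (coact A x)"
    and coact_counit: "tensor_lift (\<lambda>y h. counit H h *\<^sub>C y) (coact A x) = x"

definition coinvariants ::
  "'h::complex_vector hopf_alg \<Rightarrow> ('a::complex_vector, 'h) comod_alg \<Rightarrow> 'a set" where
  "coinvariants H A = {b. coact A b = b \<otimes> alg_one H}"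


section \<open>Balanced tensor products and faithful flatness\<close>

text \<open>Left modules over a subalgebra \<open>B\<close> of an algebra \<open>A\<close>; their carriers are subspaces of a
  vector space type, and \<open>lact b\<close> is only relevant for \<open>b \<in> B\<close> and on the carrier.\<close>

record ('a, 'm) lmodule =
  lcarrier :: "'m set"
  lact :: "'a \<Rightarrow> 'm \<Rightarrow> 'm"

locale left_module =
  fixes A :: "('a::complex_vector, 'z) alg_scheme" and B :: "'a set"
    and M :: "('a, 'm::complex_vector) lmodule"
  assumes lcarrier_subspace: "csubspace (lcarrier M)"
    and lact_closed: "b \<in> B \<Longrightarrow> m \<in> lcarrier M \<Longrightarrow> lact M b m \<in> lcarrier M"
    and lact_add_left: "b \<in> B \<Longrightarrow> b' \<in> B \<Longrightarrow> m \<in> lcarrier M \<Longrightarrow>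
      lact M (b + b') m = lact M b m + lact M b' m"
    and lact_add_right: "b \<in> B \<Longrightarrow> m \<in> lcarrier M \<Longrightarrow> m' \<in> lcarrier M \<Longrightarrow>
      lact M b (m + m') = lact M b m + lact M b m'"
    and lact_scale_left: "b \<in> B \<Longrightarrow> m \<in> lcarrier M \<Longrightarrow> lact M (c *\<^sub>C b) m = c *\<^sub>C lact M b m"
    and lact_scale_right: "b \<in> B \<Longrightarrow> m \<in> lcarrier M \<Longrightarrow> lact M b (c *\<^sub>C m) = c *\<^sub>C lact M b m"
    and lact_mult: "b \<in> B \<Longrightarrow> b' \<in> B \<Longrightarrow> m \<in> lcarrier M \<Longrightarrow>
      lact M (alg_mult A b b') m = lact M b (lact M b' m)"
    and lact_one: "m \<in> lcarrier M \<Longrightarrow> lact M (alg_one A) m = m"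

text \<open>Module homomorphisms are taken to be restrictions of linear maps of the ambient type; over a
  field every linear map on a subspace extends, so this is no restriction.\<close>

definition left_module_hom ::
  "'a set \<Rightarrow> ('a, 'm::complex_vector) lmodule \<Rightarrow> ('a, 'm) lmodule \<Rightarrow> ('m \<Rightarrow> 'm) \<Rightarrow> bool" where
  "left_module_hom B M N f \<longleftrightarrow> clinear f \<and> f ` lcarrier M \<subseteq> lcarrier N \<and>
    (\<forall>b\<in>B. \<forall>m\<in>lcarrier M. f (lact M b m) = lact N b (f m))"

text \<open>\<open>A \<otimes>\<^sub>B M\<close> is the quotient of \<open>A \<otimes> M\<close> by the span of all \<open>ab \<otimes> m - a \<otimes> bm\<close>; its elements
  are cosets.  \<open>A \<otimes> M\<close> is identified with its (injective) image in the tensor product with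
  the ambient space of \<open>M\<close>.\<close>

definition balancing ::
  "('a::complex_vector, 'z) alg_scheme \<Rightarrow> 'a set \<Rightarrow> ('a, 'm::complex_vector) lmodule
    \<Rightarrow> ('a, 'm) tensor set" where
  "balancing A B M = cspan {alg_mult A a b \<otimes> m - a \<otimes> lact M b m |a b m. b \<in> B \<and> m \<in> lcarrier M}"

definition balanced_rel ::
  "('a::complex_vector, 'z) alg_scheme \<Rightarrow> 'a set \<Rightarrow> ('a, 'm::complex_vector) lmodule
    \<Rightarrow> (('a, 'm) tensor \<times> ('a, 'm) tensor) set" where
  "balanced_rel A B M = {(s, t). s \<in> cspan {a \<otimes> m |a m. m \<in> lcarrier M} \<and>
    t \<in> cspan {a \<otimes> m |a m. m \<in> lcarrier M} \<and> s - t \<in> balancing A B M}"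

definition balanced_tensor ::
  "('a::complex_vector, 'z) alg_scheme \<Rightarrow> 'a set \<Rightarrow> ('a, 'm::complex_vector) lmodule
    \<Rightarrow> ('a, 'm) tensor set set" where
  "balanced_tensor A B M = cspan {a \<otimes> m |a m. m \<in> lcarrier M} // balanced_rel A B M"

text \<open>The map \<open>id \<otimes>\<^sub>B f\<close> into \<open>A \<otimes>\<^sub>B N\<close>.\<close>

definition balanced_map ::
  "('a::complex_vector, 'z) alg_scheme \<Rightarrow> 'a set \<Rightarrow> ('a, 'm::complex_vector) lmodule \<Rightarrow> ('m \<Rightarrow> 'm)
    \<Rightarrow> ('a, 'm) tensor set \<Rightarrow> ('a, 'm) tensor set" where
  "balanced_map A B N f X = balanced_rel A B N `` (tensor_map id f ` X)"

text \<open>\<open>A\<close> is faithfully flat as a right \<open>B\<close>-module if a sequence \<open>L \<rightarrow> M \<rightarrow> N\<close> of left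
  \<open>B\<close>-modules is exact at \<open>M\<close> precisely when \<open>A \<otimes>\<^sub>B L \<rightarrow> A \<otimes>\<^sub>B M \<rightarrow> A \<otimes>\<^sub>B N\<close> is exact.
  HOL cannot quantify over the types carrying the modules inside a formula, so the type
  \<open>'m\<close> is an explicit universe.  It should be large enough: \<open>nat \<Rightarrow>\<^sub>0 'a\<close> contains,
  up to isomorphism, every countably generated left \<open>B\<close>-module (the dimension of a quotient
  of a countable free \<open>B\<close>-module is at most that of \<open>nat \<Rightarrow>\<^sub>0 'a\<close>), and faithful
  flatness is detected on finitely generated modules (ideals and cyclic modules).\<close>

definition faithfully_flat ::
  "'m::complex_vector itself \<Rightarrow> ('a::complex_vector, 'z) alg_scheme \<Rightarrow> 'a set \<Rightarrow> bool" where
  "faithfully_flat _ A B \<longleftrightarrow>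
    (\<forall>(L :: ('a, 'm) lmodule) (M :: ('a, 'm) lmodule) (N :: ('a, 'm) lmodule) f g.
      left_module A B L \<longrightarrow> left_module A B M \<longrightarrow> left_module A B N \<longrightarrow>
      left_module_hom B L M f \<longrightarrow> left_module_hom B M N g \<longrightarrow>
      (f ` lcarrier L = {m \<in> lcarrier M. g m = 0} \<longleftrightarrow>
       balanced_map A B M f ` balanced_tensor A B L =
         {X \<in> balanced_tensor A B M. balanced_map A B N g X = balanced_rel A B N `` {0}}))"


section \<open>Hopf--Galois extensions\<close>

definition regular_module :: "('a, 'z) alg_scheme \<Rightarrow> ('a, 'a) lmodule" where
  "regular_module A = \<lparr>lcarrier = UNIV, lact = alg_mult A\<rparr>"

text \<open>\<open>A \<otimes>\<^sub>B A\<close> with \<open>B = A\<^sup>c\<^sup>o\<^sup>H\<close>.\<close>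

definition galois_domain ::
  "'h::complex_vector hopf_alg \<Rightarrow> ('a::complex_vector, 'h) comod_alg \<Rightarrow> ('a, 'a) tensor set set" where
  "galois_domain H A = balanced_tensor A (coinvariants H A) (regular_module A)"

text \<open>The lift \<open>a' \<otimes> a \<mapsto> a' a\<^sub>0 \<otimes> a\<^sub>1\<close> of the canonical map to \<open>A \<otimes> A\<close>; it is constant on the
  cosets that make up \<open>A \<otimes>\<^sub>B A\<close> (\<open>galois_map_class\<close>).\<close>

definition galois_lift ::
  "('a::complex_vector, 'h::complex_vector) comod_alg \<Rightarrow> ('a, 'a) tensor \<Rightarrow> ('a, 'h) tensor" where
  "galois_lift A = tensor_lift (\<lambda>a' a. tensor_map (alg_mult A a') id (coact A a))"

definition galois_map ::
  "('a::complex_vector, 'h::complex_vector) comod_alg \<Rightarrow> ('a, 'a) tensor set \<Rightarrow> ('a, 'h) tensor" where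
  "galois_map A X = the_elem (galois_lift A ` X)"

lemma cbilinear_comp:
  assumes "cbilinear \<phi>" "clinear f" "clinear g"
  shows "cbilinear (\<lambda>x y. \<phi> (f x) (g y))"
proof -
  have l: "clinear (\<lambda>x. \<phi> x y)" and r: "clinear (\<phi> x)" for x y
    using assms(1) by (auto simp: cbilinear_def)
  show ?thesis
    unfolding cbilinear_def
    by (auto intro!: clinearI simp: clinear_add[OF l] clinear_add[OF r] clinear_scale[OF l]
        clinear_scale[OF r] clinear_add[OF assms(2)] clinear_add[OF assms(3)]
        clinear_scale[OF assms(2)] clinear_scale[OF assms(3)])
qed

lemma clinear_id: "clinear id"
  by (rule clinearI) auto

lemma clinear_plus: "clinear f \<Longrightarrow> clinear g \<Longrightarrow> clinear (\<lambda>x. f x + g x)"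
  by (rule clinearI) (simp_all add: clinear_add clinear_scale scaleC_add_right algebra_simps)

lemma clinear_cmult: "clinear f \<Longrightarrow> clinear (\<lambda>x. c *\<^sub>C f x)"
  by (rule clinearI) (simp_all add: clinear_add clinear_scale scaleC_add_right scaleC_scaleC mult.commute)

lemma clinear_comp: "clinear f \<Longrightarrow> clinear g \<Longrightarrow> clinear (\<lambda>x. f (g x))"
  by (rule clinearI) (simp_all add: clinear_add clinear_scale)

lemma tensor_map_tensor:
  "clinear f \<Longrightarrow> clinear g \<Longrightarrow> tensor_map f g (x \<otimes> y) = f x \<otimes> g y"
  by (simp add: tensor_map_def tensor_lift_tensor cbilinear_comp tensor_bilinear)

lemma clinear_tensor_map: "clinear f \<Longrightarrow> clinear g \<Longrightarrow> clinear (tensor_map f g)"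
  by (simp add: tensor_map_def clinear_tensor_lift cbilinear_comp tensor_bilinear)

context comodule_algebra
begin

lemma galois_lift_bilinear: "cbilinear (\<lambda>a' a. tensor_map (alg_mult A a') id (coact A a))"
proof -
  have l: "clinear (\<lambda>x. alg_mult A x y)" and r: "clinear (alg_mult A x)" for x y
    using A.mult_bilinear by (auto simp: cbilinear_def)
  have tl: "clinear (\<lambda>x::'a. x \<otimes> y)" for y :: 'h
    using tensor_bilinear by (auto simp: cbilinear_def)
  note rid = tensor_map_tensor[OF r clinear_id] and lid = clinear_tensor_map[OF r clinear_id]
  have "tensor_map (alg_mult A (x + x')) id t =
      tensor_map (alg_mult A x) id t + tensor_map (alg_mult A x') id t" for x x' and t :: "('a, 'h) tensor"
    by (rule tensor_eqI[OF lid clinear_plus[OF lid lid]])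
      (simp only: rid clinear_add[OF l] clinear_add[OF tl])
  moreover have "tensor_map (alg_mult A (c *\<^sub>C x)) id t = c *\<^sub>C tensor_map (alg_mult A x) id t"
    for c x and t :: "('a, 'h) tensor"
    by (rule tensor_eqI[OF lid clinear_cmult[OF lid]])
      (simp only: rid clinear_scale[OF l] clinear_scale[OF tl])
  ultimately show ?thesis
    unfolding cbilinear_def using clinear_comp[OF lid coact_linear]
    by (blast intro: clinearI)
qed

lemma galois_lift_tensor: "galois_lift A (a' \<otimes> a) = tensor_map (alg_mult A a') id (coact A a)"
  by (simp add: galois_lift_def tensor_lift_tensor[OF galois_lift_bilinear])

lemma galois_lift_balanced:
  assumes "b \<in> coinvariants H A"
  shows "galois_lift A (alg_mult A a b \<otimes> a') = galois_lift A (a \<otimes> alg_mult A b a')"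
proof -
  have r: "clinear (alg_mult A x)" for x
    using A.mult_bilinear by (auto simp: cbilinear_def)
  note rid = tensor_map_tensor[OF r clinear_id] and lid = clinear_tensor_map[OF r clinear_id]
  have hr: "clinear (alg_mult H x)" and hl: "clinear (\<lambda>y. alg_mult H y x)" for x
    using mult_bilinear by (auto simp: cbilinear_def)
  have al: "clinear (\<lambda>y. alg_mult A y x)" for x
    using A.mult_bilinear by (auto simp: cbilinear_def)
  have bil: "cbilinear (\<lambda>x' y'. alg_mult A x x' \<otimes> alg_mult H y y')" for x y
    by (rule cbilinear_comp[OF tensor_bilinear r hr])
  have tl: "clinear (\<lambda>x::'a. x \<otimes> y)" and tr: "clinear (\<lambda>y::'h. x \<otimes> y)" for y :: 'h and x :: 'a
    using tensor_bilinear by (auto simp: cbilinear_def)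
  note L = clinear_tensor_lift[OF bil]
  have out: "cbilinear (\<lambda>x y. tensor_lift (\<lambda>x' y'. alg_mult A x x' \<otimes> alg_mult H y y') t)" for t
    unfolding cbilinear_def
  proof (intro conjI allI clinearI)
    show "tensor_lift (\<lambda>x' y'. alg_mult A (x1 + x2) x' \<otimes> alg_mult H y y') t =
      tensor_lift (\<lambda>x' y'. alg_mult A x1 x' \<otimes> alg_mult H y y') t +
      tensor_lift (\<lambda>x' y'. alg_mult A x2 x' \<otimes> alg_mult H y y') t" for x1 x2 y
      by (rule tensor_eqI[OF L clinear_plus[OF L L]])
        (simp only: tensor_lift_tensor[OF bil], simp only: clinear_add[OF al] clinear_add[OF tl])
    show "tensor_lift (\<lambda>x' y'. alg_mult A x x' \<otimes> alg_mult H (y1 + y2) y') t =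
      tensor_lift (\<lambda>x' y'. alg_mult A x x' \<otimes> alg_mult H y1 y') t +
      tensor_lift (\<lambda>x' y'. alg_mult A x x' \<otimes> alg_mult H y2 y') t" for x y1 y2
      by (rule tensor_eqI[OF L clinear_plus[OF L L]])
        (simp only: tensor_lift_tensor[OF bil], simp only: clinear_add[OF hl] clinear_add[OF tr])
    show "tensor_lift (\<lambda>x' y'. alg_mult A (c *\<^sub>C x) x' \<otimes> alg_mult H y y') t =
      c *\<^sub>C tensor_lift (\<lambda>x' y'. alg_mult A x x' \<otimes> alg_mult H y y') t" for c x y
      by (rule tensor_eqI[OF L clinear_cmult[OF L]])
        (simp only: tensor_lift_tensor[OF bil], simp only: clinear_scale[OF al] clinear_scale[OF tl])
    show "tensor_lift (\<lambda>x' y'. alg_mult A x x' \<otimes> alg_mult H (c *\<^sub>C y) y') t =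
      c *\<^sub>C tensor_lift (\<lambda>x' y'. alg_mult A x x' \<otimes> alg_mult H y y') t" for c x y
      by (rule tensor_eqI[OF L clinear_cmult[OF L]])
        (simp only: tensor_lift_tensor[OF bil], simp only: clinear_scale[OF hl] clinear_scale[OF tr])
  qed
  have "tensor_mult A H (b \<otimes> alg_one H) t = tensor_map (alg_mult A b) id t" for t
    unfolding tensor_mult_def tensor_lift_tensor[OF out]
    by (rule tensor_eqI[OF L lid])
      (simp only: tensor_lift_tensor[OF bil], simp only: rid mult_one_left id_apply)
  then have "coact A (alg_mult A b a') = tensor_map (alg_mult A b) id (coact A a')"
    using assms by (simp add: coact_mult coinvariants_def)
  moreover have "tensor_map (alg_mult A (alg_mult A a b)) id t =
      tensor_map (alg_mult A a) id (tensor_map (alg_mult A b) id t)" for t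
    by (rule tensor_eqI[OF lid clinear_comp[OF lid lid]])
      (simp only: rid A.mult_assoc id_apply)
  ultimately show ?thesis
    by (simp add: galois_lift_tensor)
qed

lemma galois_map_class:
  "galois_map A (balanced_rel A (coinvariants H A) (regular_module A) `` {t}) = galois_lift A t"
proof -
  let ?N = "balancing A (coinvariants H A) (regular_module A)"
  have L: "clinear (galois_lift A)"
    unfolding galois_lift_def by (rule clinear_tensor_lift[OF galois_lift_bilinear])
  have sub: "csubspace {u. galois_lift A u = 0}"
    unfolding complex_vector.subspace_def
    by (simp add: clinear_zero[OF L] clinear_add[OF L] clinear_scale[OF L])
  have gen: "galois_lift A u = 0"
    if gens: "u \<in> {alg_mult A a b \<otimes> m - a \<otimes> lact (regular_module A) b m |a b m.
      b \<in> coinvariants H A \<and> m \<in> lcarrier (regular_module A)}" for u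
  proof -
    obtain a b m where u: "u = alg_mult A a b \<otimes> m - a \<otimes> lact (regular_module A) b m"
      and b: "b \<in> coinvariants H A"
      using gens by blast
    show ?thesis
      using galois_lift_balanced[OF b, of a m]
      unfolding u clinear_diff[OF L] by (simp add: regular_module_def)
  qed
  have null: "galois_lift A u = 0" if "u \<in> ?N" for u
    using that[unfolded balancing_def] sub by (rule complex_vector.span_induct) (rule gen)
  have "u \<in> cspan {a \<otimes> m |a m. m \<in> lcarrier (regular_module A)}" for u
    using tensor_span[of u] by (simp add: regular_module_def)
  then have cls: "balanced_rel A (coinvariants H A) (regular_module A) `` {t} = {u. t - u \<in> ?N}"
    unfolding balanced_rel_def by blast
  have eq: "galois_lift A u = galois_lift A t" if "t - u \<in> ?N" for u
    using null[OF that] clinear_diff[OF L, of t u] by simp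
  have "t - t \<in> ?N"
    unfolding balancing_def by (simp only: diff_self complex_vector.span_zero)
  then have "galois_lift A ` {u. t - u \<in> ?N} = {galois_lift A t}"
    using eq by blast
  then have "galois_lift A ` (balanced_rel A (coinvariants H A) (regular_module A) `` {t})
      = {galois_lift A t}"
    by (simp only: cls)
  then show ?thesis by (simp add: galois_map_def)
qed

end

definition galois_invertible ::
  "'h::complex_vector hopf_alg \<Rightarrow> ('a::complex_vector, 'h) comod_alg \<Rightarrow> bool" where
  "galois_invertible H A \<longleftrightarrow> bij_betw (galois_map A) (galois_domain H A) UNIV"

definition translation_map ::
  "'h::complex_vector hopf_alg \<Rightarrow> ('a::complex_vector, 'h) comod_alg \<Rightarrow> 'h \<Rightarrow> ('a, 'a) tensor set" where
  "translation_map H A h = inv_into (galois_domain H A) (galois_map A) (alg_one A \<otimes> h)"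


section \<open>Bi-gradings and the deformation\<close>

type_synonym 'n bidegree = "(int ^ 'n) \<times> (int ^ 'n)"

definition is_decomposition ::
  "('n::finite bidegree \<Rightarrow> 'v::complex_vector set) \<Rightarrow> 'v \<Rightarrow> ('n bidegree \<Rightarrow>\<^sub>0 'v) \<Rightarrow> bool" where
  "is_decomposition G x c \<longleftrightarrow> (\<forall>d. Poly_Mapping.lookup c d \<in> G d) \<and>
    x = (\<Sum>d\<in>Poly_Mapping.keys c. Poly_Mapping.lookup c d)"

text \<open>The ambient space is the internal direct sum of the subspaces \<open>G d\<close>.\<close>

definition bigrading :: "('n::finite bidegree \<Rightarrow> 'v::complex_vector set) \<Rightarrow> bool" where
  "bigrading G \<longleftrightarrow> (\<forall>d. csubspace (G d)) \<and> (\<forall>x. \<exists>!c. is_decomposition G x c)"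

definition components ::
  "('n::finite bidegree \<Rightarrow> 'v::complex_vector set) \<Rightarrow> 'v \<Rightarrow> ('n bidegree \<Rightarrow>\<^sub>0 'v)" where
  "components G x = (THE c. is_decomposition G x c)"

text \<open>\<open>\<Oplus>\<^sub>s G (r, s) \<otimes> K (s, l)\<close> as a subspace of the tensor product; the sum is automatically direct.\<close>

definition matched_tensors ::
  "('n::finite bidegree \<Rightarrow> 'v::complex_vector set) \<Rightarrow> ('n bidegree \<Rightarrow> 'w::complex_vector set)
    \<Rightarrow> 'n bidegree \<Rightarrow> ('v, 'w) tensor set" where
  "matched_tensors G K d = cspan {x \<otimes> y |x y s. x \<in> G (fst d, s) \<and> y \<in> K (s, snd d)}"

definition graded_mult ::
  "('v, 'z) alg_scheme \<Rightarrow> ('n::finite bidegree \<Rightarrow> 'v set) \<Rightarrow> bool" where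
  "graded_mult X G \<longleftrightarrow>
    (\<forall>r s p q. \<forall>x\<in>G (r, s). \<forall>y\<in>G (p, q). alg_mult X x y \<in> G (r + p, s + q))"

text \<open>\<open>star = None\<close> if \<open>H\<close> carries no \<open>*\<close>-structure.\<close>

locale hopf_bigrading =
  fixes H :: "'h::complex_vector hopf_alg" and star :: "('h \<Rightarrow> 'h) option"
    and HG :: "'n::finite bidegree \<Rightarrow> 'h set"
  assumes hopf_graded: "bigrading HG"
    and hopf_graded_mult: "graded_mult H HG"
    and hopf_graded_comult: "comult H ` HG d \<subseteq> matched_tensors HG HG d"
    and hopf_graded_counit: "r \<noteq> l \<Longrightarrow> h \<in> HG (r, l) \<Longrightarrow> counit H h = 0"
    and hopf_graded_antipode: "antipode H ` HG (r, l) \<subseteq> HG (- l, - r)"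
    and hopf_graded_star: "star = Some st \<Longrightarrow> hopf_star H st \<and> st ` HG (r, l) \<subseteq> HG (- r, - l)"

locale comodule_bigrading =
  fixes HG :: "'n::finite bidegree \<Rightarrow> 'h::complex_vector set"
    and A :: "('a::complex_vector, 'h) comod_alg"
    and AG :: "'n bidegree \<Rightarrow> 'a set"
  assumes comodule_graded: "bigrading AG"
    and comodule_graded_mult: "graded_mult A AG"
    and comodule_graded_coact: "coact A ` AG d \<subseteq> matched_tensors AG HG d"

definition deform_phase :: "real ^ 'n ^ 'n \<Rightarrow> int ^ 'n \<Rightarrow> int ^ 'n::finite \<Rightarrow> complex" where
  "deform_phase \<theta> r l = exp (complex_of_real
     (pi * ((\<theta> *v (\<chi> i. real_of_int (r $ i))) \<bullet> (\<chi> i. real_of_int (l $ i)))) * \<i>)"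

text \<open>Replaces the product by \<open>\<cdot>\<^sub>\<Theta>\<close> and keeps all other structure; it applies to Hopf algebras and
  to comodule algebras alike.\<close>

definition deform ::
  "real ^ 'n ^ 'n \<Rightarrow> ('n::finite bidegree \<Rightarrow> 'v::complex_vector set)
    \<Rightarrow> ('v, 'z) alg_scheme \<Rightarrow> ('v, 'z) alg_scheme" where
  "deform \<theta> G X = X\<lparr>alg_mult := \<lambda>x y.
     \<Sum>(r1, r2)\<in>Poly_Mapping.keys (components G x).
     \<Sum>(l1, l2)\<in>Poly_Mapping.keys (components G y).
       (deform_phase \<theta> r1 l1 * deform_phase (- \<theta>) r2 l2) *\<^sub>C
         alg_mult X (Poly_Mapping.lookup (components G x) (r1, r2))
           (Poly_Mapping.lookup (components G y) (l1, l2))\<rparr>"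

text \<open>\<open>A \<otimes>\<^sub>B A\<close> and its deformed counterpart are both quotients of \<open>A \<otimes> A\<close>, by different subspaces
  in general.  On the following subspace of \<open>A \<otimes> A\<close>, of total first degree zero, the two
  subspaces agree, so that its images in the two quotients are literally the same vector
  space; this is where translation maps take their values.\<close>

definition first_degree_zero ::
  "('n::finite bidegree \<Rightarrow> 'v::complex_vector set) \<Rightarrow> ('v, 'v) tensor set" where
  "first_degree_zero G = cspan {x \<otimes> y |x y p r s. x \<in> G (- p, r) \<and> y \<in> G (p, s)}"

text \<open>Two translation maps into the two quotients are the same if \<open>\<tau> h\<close> and \<open>\<tau>' h\<close> have the same
  representatives \<open>\<Sum>i. x\<^sub>i \<otimes> y\<^sub>i\<close> of total first degree zero, and at least one exists.\<close>

definition same_translation_map ::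
  "('n::finite bidegree \<Rightarrow> 'a::complex_vector set) \<Rightarrow> ('h \<Rightarrow> ('a, 'a) tensor set)
    \<Rightarrow> ('h \<Rightarrow> ('a, 'a) tensor set) \<Rightarrow> bool" where
  "same_translation_map G \<tau> \<tau>' \<longleftrightarrow>
    (\<forall>h. \<tau> h \<inter> first_degree_zero G = \<tau>' h \<inter> first_degree_zero G \<and>
         \<tau> h \<inter> first_degree_zero G \<noteq> {})"

end

theory Submission
  imports Defs
begin

text \<open>
  The two Galois maps differ only by phases.  Write \<open>\<chi>\<close> and \<open>\<chi>\<^sub>\<Theta>\<close> for the lifts of both
  maps to the whole of \<open>A \<otimes> A\<close>.  Let \<open>\<phi>\<close> be the rescaling of \<open>A \<otimes> A\<close> that multiplies
  \<open>x \<otimes> y\<close>, with \<open>x\<close> of bi-degree \<open>(p, q)\<close> and \<open>y\<close> of bi-degree \<open>(p', q')\<close>, by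
  \<open>\<lambda>\<^sub>-\<^sub>\<theta>(p, p')\<close>, and let \<open>\<psi>\<close> be the rescaling of \<open>A \<otimes> H\<close> that multiplies \<open>a \<otimes> h\<close>, with \<open>a\<close> of
  bi-degree \<open>(p, q)\<close> and \<open>h\<close> of bi-degree \<open>(s, l)\<close>, by \<open>\<lambda>\<^sub>-\<^sub>\<theta>(q, s)\<close>.  Both are linear
  bijections.  Three facts carry the proof.

  First, \<open>\<chi>\<^sub>\<Theta> \<circ> \<phi> = \<psi> \<circ> \<chi>\<close> (\<open>galois_lift_deform\<close>).  In \<open>x \<cdot>\<^sub>\<Theta> y\<^sub>0 \<otimes> y\<^sub>1\<close> the product
  contributes \<open>\<lambda>\<^sub>\<theta>(p, p') \<lambda>\<^sub>-\<^sub>\<theta>(q, s)\<close>, where \<open>s\<close> is the second degree of \<open>y\<^sub>0\<close> and the first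
  degree of \<open>y\<^sub>1\<close>.  The map \<open>\<phi>\<close> cancels the first factor.  The second one is what \<open>\<psi>\<close> produces on
  \<open>x y\<^sub>0 \<otimes> y\<^sub>1\<close>, because \<open>\<lambda>\<^sub>-\<^sub>\<theta>(q + s, s) = \<lambda>\<^sub>-\<^sub>\<theta>(q, s)\<close> for skew-symmetric \<open>\<theta>\<close>.

  Secondly, \<open>\<phi>\<close> maps the relations \<open>a b \<otimes> m - a \<otimes> b m\<close> that define \<open>A \<otimes>\<^sub>B A\<close> onto those that define
  its deformation (\<open>galois_relations_deform\<close>).  The reason is that \<open>B\<close> is spanned by homogeneous
  elements of bi-degrees \<open>(r, 0)\<close> (\<open>coinvariant_component\<close>), so that only first degrees enter the
  phases of both terms.  A Galois map is invertible if and only if its lift is surjective with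
  exactly these relations as kernel, so the first two facts give the equivalence.

  Thirdly, on total first degree zero \<open>\<phi>\<close> is the identity, since \<open>\<lambda>\<^sub>-\<^sub>\<theta>(- p, p) = 1\<close>, and
  \<open>\<psi>\<close> fixes \<open>1 \<otimes> h\<close>.  Hence a tensor of total first degree zero represents \<open>\<tau>(h)\<close> for one
  extension exactly if it does so for the other.  Such representatives exist because \<open>\<chi>\<close> respects
  the total first degree, in which \<open>1 \<otimes> h\<close> has degree zero (\<open>translation_representative\<close>).
\<close>

section \<open>Linear maps on graded spaces\<close>

lemma clinear_sum: "clinear f \<Longrightarrow> f (sum g S) = (\<Sum>i\<in>S. f (g i))"
  by (simp add: Vector_Spaces.linear_iff_module_hom module_hom.sum)

lemma cbilinearD:
  assumes "cbilinear \<beta>"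
  shows "clinear (\<lambda>x. \<beta> x y)" "clinear (\<beta> x)"
  using assms by (auto simp: cbilinear_def)

lemma cbilinearI:
  assumes "\<And>y. clinear (\<lambda>x. \<beta> x y)" "\<And>x. clinear (\<beta> x)"
  shows "cbilinear \<beta>"
  using assms by (auto simp: cbilinear_def)

lemma decomposition_superset:
  assumes "finite S" "Poly_Mapping.keys c \<subseteq> S"
  shows "(\<Sum>d\<in>Poly_Mapping.keys c. Poly_Mapping.lookup c d) = (\<Sum>d\<in>S. Poly_Mapping.lookup c d)"
  by (rule sum.mono_neutral_left) (use assms in \<open>auto simp: in_keys_iff\<close>)

lemma components_decomposition:
  assumes "bigrading G"
  shows "is_decomposition G x (components G x)"
  using assms unfolding bigrading_def components_def by (metis theI')

lemma components_homogeneous: "bigrading G \<Longrightarrow> Poly_Mapping.lookup (components G x) d \<in> G d"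
  and components_sum:
    "bigrading G \<Longrightarrow> (\<Sum>d\<in>Poly_Mapping.keys (components G x). Poly_Mapping.lookup (components G x) d) = x"
  using components_decomposition[of G x] unfolding is_decomposition_def by metis+

lemma components_eqI: "bigrading G \<Longrightarrow> is_decomposition G x c \<Longrightarrow> components G x = c"
  using components_decomposition[of G x] unfolding bigrading_def by blast

lemma bigrading_subspace: "bigrading G \<Longrightarrow> csubspace (G d)"
  unfolding bigrading_def by blast

lemma clinear_components:
  assumes G: "bigrading G"
  shows "clinear (components G)"
proof (rule clinearI)
  let ?c = "components G"
  fix x y a
  let ?S = "Poly_Mapping.keys (?c x) \<union> Poly_Mapping.keys (?c y)"
  note sub = bigrading_subspace[OF G]
  have x: "x = (\<Sum>d\<in>?S. Poly_Mapping.lookup (?c x) d)"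
    and y: "y = (\<Sum>d\<in>?S. Poly_Mapping.lookup (?c y) d)"
    by (subst decomposition_superset[symmetric]; simp add: components_sum[OF G])+
  show "?c (x + y) = ?c x + ?c y"
  proof (rule components_eqI[OF G])
    have "(\<Sum>d\<in>Poly_Mapping.keys (?c x + ?c y). Poly_Mapping.lookup (?c x + ?c y) d)
      = (\<Sum>d\<in>?S. Poly_Mapping.lookup (?c x + ?c y) d)"
      by (rule decomposition_superset) (auto simp: Poly_Mapping.keys_add)
    also have "\<dots> = x + y"
      unfolding lookup_add sum.distrib x[symmetric] y[symmetric] ..
    finally show "is_decomposition G (x + y) (?c x + ?c y)"
      unfolding is_decomposition_def
      by (auto simp: lookup_add intro: complex_vector.subspace_add[OF sub] components_homogeneous[OF G])
  qed
  show "?c (a *\<^sub>C x) = a *\<^sub>C ?c x"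
  proof (rule components_eqI[OF G])
    have "(\<Sum>d\<in>Poly_Mapping.keys (a *\<^sub>C ?c x). Poly_Mapping.lookup (a *\<^sub>C ?c x) d)
      = (\<Sum>d\<in>Poly_Mapping.keys (?c x). Poly_Mapping.lookup (a *\<^sub>C ?c x) d)"
      by (rule decomposition_superset) (auto simp: in_keys_iff lookup_scaleC)
    also have "\<dots> = a *\<^sub>C x"
      by (simp add: lookup_scaleC complex_vector.scale_sum_right[symmetric] components_sum[OF G])
    finally show "is_decomposition G (a *\<^sub>C x) (a *\<^sub>C ?c x)"
      unfolding is_decomposition_def
      by (auto simp: lookup_scaleC intro: complex_vector.subspace_scale[OF sub] components_homogeneous[OF G])
  qed
qed

lemma components_of_homogeneous:
  assumes G: "bigrading G" and x: "x \<in> G d"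
  shows "components G x = Poly_Mapping.single d x"
  by (rule components_eqI[OF G])
    (use x complex_vector.subspace_0[OF bigrading_subspace[OF G]] in
      \<open>auto simp: is_decomposition_def lookup_single when_def\<close>)

lemma clinear_eq_graded:
  assumes G: "bigrading G" and "clinear f" "clinear g"
    and "\<And>d x. x \<in> G d \<Longrightarrow> f x = g x"
  shows "f x = g x"
proof -
  have "f (\<Sum>d\<in>Poly_Mapping.keys (components G x). Poly_Mapping.lookup (components G x) d) =
    g (\<Sum>d\<in>Poly_Mapping.keys (components G x). Poly_Mapping.lookup (components G x) d)"
    using assms(4)[OF components_homogeneous[OF G]]
    by (simp only: clinear_sum[OF assms(2)] clinear_sum[OF assms(3)])
  then show ?thesis by (simp only: components_sum[OF G])
qed

lemma cbilinear_eq_graded: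
  assumes "bigrading G" "bigrading K" "cbilinear \<beta>" "cbilinear \<gamma>"
    and "\<And>d e x y. x \<in> G d \<Longrightarrow> y \<in> K e \<Longrightarrow> \<beta> x y = \<gamma> x y"
  shows "\<beta> x y = \<gamma> x y"
proof (rule clinear_eq_graded[OF assms(1) cbilinearD(1)[OF assms(3)] cbilinearD(1)[OF assms(4)]])
  fix d x assume "x \<in> G d"
  then show "\<beta> x y = \<gamma> x y"
    by (rule clinear_eq_graded[OF assms(2) cbilinearD(2)[OF assms(3)] cbilinearD(2)[OF assms(4)] assms(5)])
qed

lemma clinear_eq_graded_tensor:
  fixes f g :: "('v::complex_vector, 'w::complex_vector) tensor \<Rightarrow> 'u::complex_vector"
  assumes "bigrading G" "bigrading K" "clinear f" "clinear g"
    and "\<And>d e x y. x \<in> G d \<Longrightarrow> y \<in> K e \<Longrightarrow> f (x \<otimes> y) = g (x \<otimes> y)"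
  shows "f t = g t"
proof (rule tensor_eqI[OF assms(3,4)])
  have b: "cbilinear (\<lambda>x y. h (x \<otimes> y))" if "clinear h" for h :: "('v, 'w) tensor \<Rightarrow> 'u"
    by (rule cbilinearI; rule clinear_comp[OF that]; rule cbilinearD[OF tensor_bilinear])
  show "f (x \<otimes> y) = g (x \<otimes> y)" for x y
    by (rule cbilinear_eq_graded[OF assms(1,2) b[OF assms(3)] b[OF assms(4)]]) (rule assms(5))
qed


section \<open>Rescaling bilinear maps by functions of the degrees\<close>

text \<open>If \<open>\<beta>\<close> is the product, this is the shape of the deformed product; if \<open>\<beta>\<close> is \<open>(\<otimes>)\<close>, it induces the
  diagonal operators \<open>rescale\<close> on a tensor product.  Sharing the definition makes one calculus of
  weights serve both.\<close>

definition twist ::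
  "('n::finite bidegree \<Rightarrow> 'v::complex_vector set) \<Rightarrow> ('n bidegree \<Rightarrow> 'w::complex_vector set)
    \<Rightarrow> ('n bidegree \<Rightarrow> 'n bidegree \<Rightarrow> complex) \<Rightarrow> ('v \<Rightarrow> 'w \<Rightarrow> 'u::complex_vector) \<Rightarrow> 'v \<Rightarrow> 'w \<Rightarrow> 'u" where
  "twist G K c \<beta> x y =
    (\<Sum>d\<in>Poly_Mapping.keys (components G x). \<Sum>e\<in>Poly_Mapping.keys (components K y).
      c d e *\<^sub>C \<beta> (Poly_Mapping.lookup (components G x) d) (Poly_Mapping.lookup (components K y) e))"

text \<open>The summation ranges of \<open>twist\<close> depend on its arguments; passing to common larger ranges makes
  its additivity visible.\<close>

lemma twist_superset:
  assumes \<beta>: "cbilinear \<beta>" and S: "finite S" "Poly_Mapping.keys (components G x) \<subseteq> S"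
    and T: "finite T" "Poly_Mapping.keys (components K y) \<subseteq> T"
  shows "twist G K c \<beta> x y = (\<Sum>d\<in>S. \<Sum>e\<in>T.
    c d e *\<^sub>C \<beta> (Poly_Mapping.lookup (components G x) d) (Poly_Mapping.lookup (components K y) e))"
proof -
  have z: "\<beta> 0 y = 0" "\<beta> x 0 = 0" for x y
    using clinear_zero cbilinearD[OF \<beta>] by blast+
  have "twist G K c \<beta> x y =
    (\<Sum>d\<in>Poly_Mapping.keys (components G x). \<Sum>e\<in>T.
      c d e *\<^sub>C \<beta> (Poly_Mapping.lookup (components G x) d) (Poly_Mapping.lookup (components K y) e))"
    unfolding twist_def
    by (intro sum.cong refl sum.mono_neutral_left) (use T in \<open>auto simp: in_keys_iff z\<close>)
  also have "\<dots> = (\<Sum>d\<in>S. \<Sum>e\<in>T.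
    c d e *\<^sub>C \<beta> (Poly_Mapping.lookup (components G x) d) (Poly_Mapping.lookup (components K y) e))"
    by (rule sum.mono_neutral_left) (use S in \<open>auto simp: in_keys_iff z\<close>)
  finally show ?thesis .
qed

lemma cbilinear_twist:
  assumes G: "bigrading G" and K: "bigrading K" and \<beta>: "cbilinear \<beta>"
  shows "cbilinear (twist G K c \<beta>)"
proof (rule cbilinearI; rule clinearI)
  note sup = twist_superset[OF \<beta>]
  note l = cbilinearD(1)[OF \<beta>] and r = cbilinearD(2)[OF \<beta>]
  note cG = clinear_components[OF G] and cK = clinear_components[OF K]
  note dist = scaleC_add_right sum.distrib complex_vector.scale_sum_right scaleC_scaleC mult.commute
  have kp: "Poly_Mapping.keys (p + q) \<subseteq> Poly_Mapping.keys p \<union> Poly_Mapping.keys q"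
    for p q :: "'a bidegree \<Rightarrow>\<^sub>0 'z::complex_vector"
    by (rule Poly_Mapping.keys_add)
  have ks: "Poly_Mapping.keys (a *\<^sub>C p) \<subseteq> Poly_Mapping.keys p"
    for a and p :: "'a bidegree \<Rightarrow>\<^sub>0 'z::complex_vector"
    by (auto simp: in_keys_iff lookup_scaleC)
  show "twist G K c \<beta> (x + x') y = twist G K c \<beta> x y + twist G K c \<beta> x' y" for x x' y
    by (simp add: sup[where S = "Poly_Mapping.keys (components G x) \<union> Poly_Mapping.keys (components G x')"
          and T = "Poly_Mapping.keys (components K y)"] kp clinear_add[OF cG] clinear_add[OF l] lookup_add dist)
  show "twist G K c \<beta> x (y + y') = twist G K c \<beta> x y + twist G K c \<beta> x y'" for x y y'
    by (simp add: sup[where T = "Poly_Mapping.keys (components K y) \<union> Poly_Mapping.keys (components K y')"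
          and S = "Poly_Mapping.keys (components G x)"] kp clinear_add[OF cK] clinear_add[OF r] lookup_add dist)
  show "twist G K c \<beta> (a *\<^sub>C x) y = a *\<^sub>C twist G K c \<beta> x y" for a x y
    by (simp add: sup[where S = "Poly_Mapping.keys (components G x)"
          and T = "Poly_Mapping.keys (components K y)"] ks clinear_scale[OF cG] clinear_scale[OF l] lookup_scaleC dist)
  show "twist G K c \<beta> x (a *\<^sub>C y) = a *\<^sub>C twist G K c \<beta> x y" for a x y
    by (simp add: sup[where S = "Poly_Mapping.keys (components G x)"
          and T = "Poly_Mapping.keys (components K y)"] ks clinear_scale[OF cK] clinear_scale[OF r] lookup_scaleC dist)
qed

lemma twist_homogeneous:
  assumes "bigrading G" "bigrading K" "cbilinear \<beta>" "x \<in> G d" "y \<in> K e"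
  shows "twist G K c \<beta> x y = c d e *\<^sub>C \<beta> x y"
  by (subst twist_superset[OF assms(3), where S = "{d}" and T = "{e}"])
    (simp_all add: components_of_homogeneous[OF assms(1,4)] components_of_homogeneous[OF assms(2,5)])

lemma twist_one:
  assumes "bigrading G" "bigrading K" "cbilinear \<beta>"
  shows "twist G K (\<lambda>d e. 1) \<beta> = \<beta>"
  by (rule ext, rule ext, rule cbilinear_eq_graded[OF assms(1,2) cbilinear_twist[OF assms] assms(3)])
    (simp add: twist_homogeneous[OF assms] scaleC_one)

abbreviation rescale ::
  "('n::finite bidegree \<Rightarrow> 'v::complex_vector set) \<Rightarrow> ('n bidegree \<Rightarrow> 'w::complex_vector set)
    \<Rightarrow> ('n bidegree \<Rightarrow> 'n bidegree \<Rightarrow> complex) \<Rightarrow> ('v, 'w) tensor \<Rightarrow> ('v, 'w) tensor" where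
  "rescale G K c \<equiv> tensor_lift (twist G K c (\<otimes>))"

lemma clinear_rescale: "bigrading G \<Longrightarrow> bigrading K \<Longrightarrow> clinear (rescale G K c)"
  by (intro clinear_tensor_lift cbilinear_twist tensor_bilinear)

lemma rescale_homogeneous:
  "bigrading G \<Longrightarrow> bigrading K \<Longrightarrow> x \<in> G d \<Longrightarrow> y \<in> K e \<Longrightarrow>
    rescale G K c (x \<otimes> y) = c d e *\<^sub>C (x \<otimes> y)"
  by (simp add: tensor_lift_tensor[OF cbilinear_twist] tensor_bilinear twist_homogeneous[OF _ _ tensor_bilinear])

lemma rescale_inverse:
  assumes "bigrading G" "bigrading K" and "\<And>d e. c d e * c' d e = 1"
  shows "rescale G K c (rescale G K c' t) = t"
proof -
  note L = clinear_rescale[OF assms(1,2)]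
  have "rescale G K c (rescale G K c' t) = id t"
    by (rule clinear_eq_graded_tensor[OF assms(1,2) clinear_comp[OF L L] clinear_id])
      (simp add: rescale_homogeneous[OF assms(1,2)] clinear_scale[OF L] scaleC_scaleC
        assms(3) mult.commute[of "c' _ _"] scaleC_one)
  then show ?thesis by simp
qed

lemma bij_rescale:
  assumes "bigrading G" "bigrading K" and "\<And>d e. c d e \<noteq> 0"
  shows "bij (rescale G K c)"
  by (rule o_bij[where g = "rescale G K (\<lambda>d e. inverse (c d e))"])
    (auto simp: fun_eq_iff rescale_inverse assms)


section \<open>The Galois map as a linear map on the full tensor product\<close>

text \<open>A bilinear product and a linear coaction suffice, so the lemma applies directly to the
  deformed pair.\<close>

lemma cbilinear_galois:
  assumes m: "cbilinear (alg_mult A)" and d: "clinear (coact A)"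
  shows "cbilinear (\<lambda>a' a. tensor_map (alg_mult A a') id (coact A a))"
proof -
  note l = cbilinearD(1)[OF m] and r = cbilinearD(2)[OF m]
  note tl = cbilinearD(1)[OF tensor_bilinear]
  note rid = tensor_map_tensor[OF r clinear_id] and lid = clinear_tensor_map[OF r clinear_id]
  have "tensor_map (alg_mult A (x + x')) id t =
      tensor_map (alg_mult A x) id t + tensor_map (alg_mult A x') id t" for x x' t
    by (rule tensor_eqI[OF lid clinear_plus[OF lid lid]])
      (simp only: rid clinear_add[OF l] clinear_add[OF tl])
  moreover have "tensor_map (alg_mult A (c *\<^sub>C x)) id t = c *\<^sub>C tensor_map (alg_mult A x) id t"
    for c x t
    by (rule tensor_eqI[OF lid clinear_cmult[OF lid]])
      (simp only: rid clinear_scale[OF l] clinear_scale[OF tl])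
  ultimately show ?thesis
    by (intro cbilinearI[OF clinearI clinear_comp[OF lid d]])
qed

lemma clinear_galois_lift:
  "cbilinear (alg_mult A) \<Longrightarrow> clinear (coact A) \<Longrightarrow> clinear (galois_lift A)"
  unfolding galois_lift_def by (intro clinear_tensor_lift cbilinear_galois)

lemma galois_lift_pure:
  "cbilinear (alg_mult A) \<Longrightarrow> clinear (coact A) \<Longrightarrow>
    galois_lift A (a' \<otimes> a) = tensor_map (alg_mult A a') id (coact A a)"
  unfolding galois_lift_def by (intro tensor_lift_tensor cbilinear_galois)

text \<open>The kernel of the projection from \<open>A \<otimes> A\<close> onto \<open>A \<otimes>\<^sub>B A\<close>.\<close>

abbreviation galois_relations ::
  "'h::complex_vector hopf_alg \<Rightarrow> ('a::complex_vector, 'h) comod_alg \<Rightarrow> ('a, 'a) tensor set" where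
  "galois_relations H A \<equiv> balancing A (coinvariants H A) (regular_module A)"

lemma galois_relations_eq:
  "galois_relations H A =
    cspan {alg_mult A a b \<otimes> m - a \<otimes> alg_mult A b m |a b m. b \<in> coinvariants H A}"
  by (simp add: balancing_def regular_module_def)

context
  fixes H :: "'h::complex_vector hopf_alg" and A :: "('a::complex_vector, 'h) comod_alg"
  assumes L: "clinear (galois_lift A)"
    and null: "\<And>u. u \<in> galois_relations H A \<Longrightarrow> galois_lift A u = 0"
begin

lemma galois_relations_subspace: "csubspace (galois_relations H A)"
  by (simp add: balancing_def)

lemma regular_span: "cspan {a \<otimes> m |a m. m \<in> lcarrier (regular_module A)} = UNIV"
proof -
  have "t \<in> cspan {a \<otimes> m |a m. m \<in> lcarrier (regular_module A)}" for t
    using tensor_span[of t] by (simp add: regular_module_def)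
  then show ?thesis by blast
qed

lemma galois_class:
  "balanced_rel A (coinvariants H A) (regular_module A) `` {t} = {u. t - u \<in> galois_relations H A}"
  by (simp add: balanced_rel_def regular_span Image_def)

lemma galois_domain_eq: "galois_domain H A = range (\<lambda>t. {u. t - u \<in> galois_relations H A})"
  unfolding galois_domain_def balanced_tensor_def quotient_def regular_span galois_class
  by (rule UNION_singleton_eq_range)

lemma galois_map_coset: "galois_map A {u. t - u \<in> galois_relations H A} = galois_lift A t"
proof -
  have "t \<in> {u. t - u \<in> galois_relations H A}"
    using complex_vector.subspace_0[OF galois_relations_subspace] by simp
  moreover have "galois_lift A u = galois_lift A t" if "t - u \<in> galois_relations H A" for u
    using null[OF that] clinear_diff[OF L, of t u] by simp
  ultimately have "galois_lift A ` {u. t - u \<in> galois_relations H A} = {galois_lift A t}"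
    by blast
  then show ?thesis by (simp add: galois_map_def)
qed

text \<open>Passing from \<open>A \<otimes>\<^sub>B A\<close> to the linear map on \<open>A \<otimes> A\<close> removes the cosets, which live in different
  quotients for the original and the deformed extension.\<close>

lemma galois_invertible_iff:
  "galois_invertible H A \<longleftrightarrow>
    surj (galois_lift A) \<and> (\<forall>t. galois_lift A t = 0 \<longrightarrow> t \<in> galois_relations H A)"
proof -
  let ?cl = "\<lambda>t. {u. t - u \<in> galois_relations H A}"
  have im: "galois_map A ` galois_domain H A = range (galois_lift A)"
    by (simp add: galois_domain_eq image_image galois_map_coset)
  have "inj_on (galois_map A) (galois_domain H A) \<longleftrightarrow>
      (\<forall>s t. galois_lift A s = galois_lift A t \<longrightarrow> ?cl s = ?cl t)"
    by (simp add: inj_on_def galois_domain_eq galois_map_coset)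
  also have "\<dots> \<longleftrightarrow> (\<forall>t. galois_lift A t = 0 \<longrightarrow> t \<in> galois_relations H A)"
  proof (intro iffI allI impI)
    fix t assume *: "\<forall>s t. galois_lift A s = galois_lift A t \<longrightarrow> ?cl s = ?cl t"
      and t: "galois_lift A t = 0"
    have "?cl t = ?cl 0"
      by (rule *[rule_format]) (simp add: t clinear_zero[OF L])
    moreover have "0 \<in> ?cl 0"
      using complex_vector.subspace_0[OF galois_relations_subspace] by simp
    ultimately have "0 \<in> ?cl t" by (rule ssubst)
    then show "t \<in> galois_relations H A" by simp
  next
    fix s t assume *: "\<forall>t. galois_lift A t = 0 \<longrightarrow> t \<in> galois_relations H A"
      and eq: "galois_lift A s = galois_lift A t"
    have st: "s - t \<in> galois_relations H A"
      using * eq clinear_diff[OF L, of s t] by simp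
    have "s - u \<in> galois_relations H A" if "t - u \<in> galois_relations H A" for u
      using complex_vector.subspace_add[OF galois_relations_subspace st that] by simp
    moreover have "t - u \<in> galois_relations H A" if "s - u \<in> galois_relations H A" for u
      using complex_vector.subspace_diff[OF galois_relations_subspace that st] by simp
    ultimately show "?cl s = ?cl t"
      by (intro Collect_cong iffI)
  qed
  finally show ?thesis
    by (simp add: galois_invertible_def bij_betw_def im conj_commute)
qed

lemma translation_map_fibre:
  assumes inv: "galois_invertible H A"
  shows "translation_map H A h = {t. galois_lift A t = alg_one A \<otimes> h}"
proof -
  have "surj (galois_lift A)" and ker: "\<And>t. galois_lift A t = 0 \<Longrightarrow> t \<in> galois_relations H A"
    using inv by (simp_all add: galois_invertible_iff)
  then obtain t where t: "alg_one A \<otimes> h = galois_lift A t"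
    by (elim surjE)
  have "translation_map H A h = {u. t - u \<in> galois_relations H A}"
    unfolding translation_map_def
  proof (rule inv_into_f_eq)
    show "inj_on (galois_map A) (galois_domain H A)"
      using inv by (simp add: galois_invertible_def bij_betw_def)
    show "{u. t - u \<in> galois_relations H A} \<in> galois_domain H A"
      unfolding galois_domain_eq by (rule rangeI)
    show "galois_map A {u. t - u \<in> galois_relations H A} = alg_one A \<otimes> h"
      by (simp only: galois_map_coset t)
  qed
  moreover have "t - u \<in> galois_relations H A \<longleftrightarrow> galois_lift A u = alg_one A \<otimes> h" for u
  proof -
    have "t - u \<in> galois_relations H A \<longleftrightarrow> galois_lift A (t - u) = 0"
      using null[of "t - u"] ker[of "t - u"] by blast
    then show ?thesis
      by (auto simp: clinear_diff[OF L] t)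
  qed
  ultimately show ?thesis
    by simp
qed

end


section \<open>Degrees of the unit and of the coinvariants\<close>

text \<open>Comparing the components of degree \<open>d\<close> in \<open>x = x 1\<close> for \<open>x\<close> of degree \<open>d\<close> shows that the
  component of \<open>1\<close> of degree zero is already a right unit.\<close>

lemma unit_degree_zero:
  assumes X: "complex_algebra X" and G: "bigrading G" and m: "graded_mult X G"
  shows "alg_one X \<in> G (0, 0)"
proof -
  interpret complex_algebra X by fact
  note l = cbilinearD(1)[OF mult_bilinear] and r = cbilinearD(2)[OF mult_bilinear]
  let ?c = "components G (alg_one X)"
  let ?u = "Poly_Mapping.lookup ?c (0, 0)"
  have "alg_mult X x ?u = x" if x: "x \<in> G d" for x d
  proof -
    let ?p = "Poly_Mapping.lookup"
    have D: "alg_mult X x (?p ?c e) \<in> G (d + e)" for e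
      using m x components_homogeneous[OF G, of "alg_one X" e]
      unfolding graded_mult_def by (cases d; cases e) auto
    have "x = alg_mult X x (\<Sum>e\<in>Poly_Mapping.keys ?c. ?p ?c e)"
      by (simp add: components_sum[OF G] mult_one_right)
    also have "\<dots> = (\<Sum>e\<in>Poly_Mapping.keys ?c. alg_mult X x (?p ?c e))"
      by (rule clinear_sum[OF r])
    finally have "components G x = (\<Sum>e\<in>Poly_Mapping.keys ?c. components G (alg_mult X x (?p ?c e)))"
      using clinear_sum[OF clinear_components[OF G]] by metis
    then have "Poly_Mapping.single d x = (\<Sum>e\<in>Poly_Mapping.keys ?c. Poly_Mapping.single (d + e) (alg_mult X x (?p ?c e)))"
      by (simp add: components_of_homogeneous[OF G D] components_of_homogeneous[OF G x])
    from arg_cong[OF this, of "\<lambda>p. ?p p d"]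
    have "x = (\<Sum>e\<in>Poly_Mapping.keys ?c. if e = 0 then alg_mult X x (?p ?c e) else 0)"
      by (simp add: lookup_sum lookup_single when_def)
    also have "\<dots> = alg_mult X x (?p ?c 0)"
      by (simp add: in_keys_iff clinear_zero[OF r])
    finally show ?thesis by (simp add: zero_prod_def)
  qed
  then have "alg_mult X x ?u = id x" for x
    using clinear_eq_graded[OF G l clinear_id] by simp
  from this[of "alg_one X"] have "?u = alg_one X"
    by (simp add: mult_one_left)
  then show ?thesis
    using components_homogeneous[OF G, of "alg_one X" "(0, 0)"] by simp
qed

locale graded_extension = comodule_algebra H A + comodule_bigrading HG A AG
  for H :: "'h::complex_vector hopf_alg" and A :: "('a::complex_vector, 'h) comod_alg"
    and HG :: "'n::finite bidegree \<Rightarrow> 'h set" and AG :: "'n bidegree \<Rightarrow> 'a set" +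
  assumes hopf_graded: "bigrading HG" and hopf_graded_mult: "graded_mult H HG"
begin

lemmas AA = comodule_graded comodule_graded and AH = comodule_graded hopf_graded

lemma hopf_unit_degree: "alg_one H \<in> HG (0, 0)"
  using complex_algebra_axioms hopf_graded hopf_graded_mult by (rule unit_degree_zero)

lemma unit_degree: "alg_one A \<in> AG (0, 0)"
  using A.complex_algebra_axioms comodule_graded comodule_graded_mult by (rule unit_degree_zero)

lemma coact_matched_induct:
  assumes "x \<in> AG (r, l)" "clinear f" "clinear g"
    and "\<And>s u h. u \<in> AG (r, s) \<Longrightarrow> h \<in> HG (s, l) \<Longrightarrow> f (u \<otimes> h) = g (u \<otimes> h)"
  shows "f (coact A x) = g (coact A x)"
proof -
  have "coact A x \<in> cspan {u \<otimes> h |u h s. u \<in> AG (r, s) \<and> h \<in> HG (s, l)}"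
    using comodule_graded_coact[of "(r, l)"] assms(1) by (auto simp: matched_tensors_def)
  moreover have "csubspace {t. f t = g t}"
    unfolding complex_vector.subspace_def
    by (simp add: clinear_zero[OF assms(2)] clinear_add[OF assms(2)] clinear_scale[OF assms(2)]
        clinear_zero[OF assms(3)] clinear_add[OF assms(3)] clinear_scale[OF assms(3)])
  ultimately show ?thesis
    by (rule complex_vector.span_induct) (use assms(4) in blast)
qed

text \<open>In \<open>coact A b = b \<otimes> 1\<close> compare the parts whose outermost degrees (the first degree of the left
  factor and the second degree of the right factor) are \<open>(r, l)\<close>.  On the left this is the coaction
  of the component of \<open>b\<close> of degree \<open>(r, l)\<close>.  On the right it vanishes unless \<open>l = 0\<close>, since \<open>1\<close>
  has degree zero, and otherwise collects all components of \<open>b\<close> of first degree \<open>r\<close>.  Applying the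
  counit identifies these components.\<close>

lemma coinvariant_component:
  assumes b: "b \<in> coinvariants H A"
  shows "l \<noteq> 0 \<Longrightarrow> Poly_Mapping.lookup (components AG b) (r, l) = 0"
    and "Poly_Mapping.lookup (components AG b) d \<in> coinvariants H A"
proof -
  let ?b = "\<lambda>d. Poly_Mapping.lookup (components AG b) d"
  note tl = cbilinearD(1)[OF tensor_bilinear]
  have sub: "csubspace (AG d)" for d by (rule bigrading_subspace[OF comodule_graded])
  have *: "coact A (?b (r, l)) =
      (if l = 0 then \<Sum>d\<in>Poly_Mapping.keys (components AG b). if fst d = r then ?b d else 0 else 0) \<otimes> alg_one H"
    for r l
  proof -
    \<comment> \<open>With these weights \<open>rescale\<close> is the projection onto outermost degrees \<open>(r, l)\<close>.\<close>
    define c where "c d e = (if fst d = r \<and> snd e = l then 1 else 0 :: complex)" for d e :: "'n bidegree"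
    let ?K = "Poly_Mapping.keys (components AG b)"
    let ?P = "rescale AG HG c"
    note P = clinear_rescale[OF AH, of c]
    have hom: "?P (coact A x) = (if d = (r, l) then coact A x else 0)" if "x \<in> AG d" for x d
    proof -
      obtain r' l' where d: "d = (r', l')" by (cases d)
      have "?P (coact A x) = (if d = (r, l) then 1 else 0) *\<^sub>C coact A x"
        using that unfolding d
        by (rule coact_matched_induct[OF _ P clinear_cmult[OF clinear_id[unfolded id_def]]])
          (auto simp: rescale_homogeneous[OF AH] c_def)
      then show ?thesis by (simp add: scaleC_one)
    qed
    have "?P (coact A b) = ?P (coact A (\<Sum>d\<in>?K. ?b d))"
      by (simp only: components_sum[OF comodule_graded])
    also have "\<dots> = (\<Sum>d\<in>?K. ?P (coact A (?b d)))"
      by (simp only: clinear_sum[OF coact_linear] clinear_sum[OF P])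
    also have "\<dots> = (\<Sum>d\<in>?K. if d = (r, l) then coact A (?b d) else 0)"
      using hom[OF components_homogeneous[OF comodule_graded]] by simp
    also have "\<dots> = coact A (?b (r, l))"
      by (simp add: in_keys_iff clinear_zero[OF coact_linear])
    finally have 1: "?P (coact A b) = coact A (?b (r, l))" .
    have "?P (b \<otimes> alg_one H) = ?P ((\<Sum>d\<in>?K. ?b d) \<otimes> alg_one H)"
      by (simp only: components_sum[OF comodule_graded])
    also have "\<dots> = (\<Sum>d\<in>?K. ?P (?b d \<otimes> alg_one H))"
      by (simp only: clinear_sum[OF tl] clinear_sum[OF P])
    also have "\<dots> = (\<Sum>d\<in>?K. (if l = 0 then if fst d = r then ?b d else 0 else 0) \<otimes> alg_one H)"
      by (intro sum.cong refl)
        (auto simp: rescale_homogeneous[OF AH components_homogeneous[OF comodule_graded] hopf_unit_degree]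
            c_def scaleC_one clinear_zero[OF tl])
    also have "\<dots> = (if l = 0 then \<Sum>d\<in>?K. if fst d = r then ?b d else 0 else 0) \<otimes> alg_one H"
      by (simp add: clinear_sum[OF tl, symmetric])
    finally show ?thesis
      using b 1 by (simp add: coinvariants_def)
  qed
  have bil: "cbilinear (\<lambda>y h. counit H h *\<^sub>C y)"
    by (intro cbilinearI clinearI)
      (simp_all add: scaleC_add_right scaleC_add_left clinear_add[OF counit_linear]
        clinear_scale[OF counit_linear] scaleC_complex_def scaleC_scaleC mult.commute)
  \<comment> \<open>Apply \<open>id \<otimes> \<epsilon>\<close> to both sides.\<close>
  have **: "?b (r, l) =
      (if l = 0 then \<Sum>d\<in>Poly_Mapping.keys (components AG b). if fst d = r then ?b d else 0 else 0)"
    for r l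
    using coact_counit[of "?b (r, l)"]
    unfolding * tensor_lift_tensor[OF bil] counit_one scaleC_one by (rule sym)
  show "l \<noteq> 0 \<Longrightarrow> ?b (r, l) = 0"
    using ** by simp
  have "coact A (?b (r, l)) = ?b (r, l) \<otimes> alg_one H" for r l
    using *[of r l] **[of r l] by simp
  then show "?b d \<in> coinvariants H A"
    by (cases d) (simp add: coinvariants_def)
qed


section \<open>Intertwining the two Galois maps\<close>

text \<open>The condition on the weights compares the two sides on \<open>x \<otimes> y\<close> with \<open>x\<close> of degree \<open>(p, q)\<close>, \<open>y\<close> of
  degree \<open>(p', q')\<close>, \<open>y\<^sub>0\<close> of degree \<open>(p', s)\<close> and \<open>y\<^sub>1\<close> of degree \<open>(s, q')\<close>.  Arbitrary weights are
  allowed so that the lemma covers, besides the deformation phases, projections onto graded parts with an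
  undeformed product.\<close>

lemma rescale_galois_lift:
  assumes A': "alg_mult A' = twist AG AG m (alg_mult A)" "coact A' = coact A"
    and w: "\<And>p q p' q' s. m (p, q) (p', s) * c (p, q) (p', q') = c' (p + p', q + s) (s, q')"
  shows "galois_lift A' (rescale AG AG c t) = rescale AG HG c' (galois_lift A t)"
proof -
  have m': "cbilinear (alg_mult A')"
    unfolding A' by (rule cbilinear_twist[OF AA A.mult_bilinear])
  have d': "clinear (coact A')" using coact_linear A' by simp
  note L = clinear_galois_lift[OF A.mult_bilinear coact_linear] and L' = clinear_galois_lift[OF m' d']
  note R = clinear_rescale[OF AA] and S = clinear_rescale[OF AH]
  note M = clinear_tensor_map[OF cbilinearD(2)[OF A.mult_bilinear] clinear_id]
  note M' = clinear_tensor_map[OF cbilinearD(2)[OF m'] clinear_id]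
  note Mt = tensor_map_tensor[OF cbilinearD(2)[OF A.mult_bilinear] clinear_id]
  note Mt' = tensor_map_tensor[OF cbilinearD(2)[OF m'] clinear_id]
  show ?thesis
  proof (rule clinear_eq_graded_tensor[OF AA clinear_comp[OF L' R] clinear_comp[OF S L]])
    fix d e x y assume x: "x \<in> AG d" and y: "y \<in> AG e"
    obtain p q p' q' where d: "d = (p, q)" and e: "e = (p', q')" by (cases d; cases e)
    have "c d e *\<^sub>C tensor_map (alg_mult A' x) id (coact A y) =
      rescale AG HG c' (tensor_map (alg_mult A x) id (coact A y))"
      using y unfolding e
    proof (rule coact_matched_induct[OF _ clinear_cmult[OF M'] clinear_comp[OF S M]])
      fix s u h assume u: "u \<in> AG (p', s)" and h: "h \<in> HG (s, q')"
      have xu: "alg_mult A x u \<in> AG (p + p', q + s)"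
        using comodule_graded_mult x u unfolding d graded_mult_def by blast
      have "tensor_map (alg_mult A' x) id (u \<otimes> h) = m d (p', s) *\<^sub>C (alg_mult A x u \<otimes> h)"
        unfolding Mt' unfolding A'(1) twist_homogeneous[OF AA A.mult_bilinear x u] id_apply
        by (rule clinear_scale[OF cbilinearD(1)[OF tensor_bilinear]])
      then show "c d (p', q') *\<^sub>C tensor_map (alg_mult A' x) id (u \<otimes> h) =
          rescale AG HG c' (tensor_map (alg_mult A x) id (u \<otimes> h))"
        by (simp add: Mt rescale_homogeneous[OF AH xu h] scaleC_scaleC d mult.commute flip: w)
    qed
    then show "galois_lift A' (rescale AG AG c (x \<otimes> y)) = rescale AG HG c' (galois_lift A (x \<otimes> y))"
      by (simp add: rescale_homogeneous[OF AA x y] clinear_scale[OF L'] galois_lift_pure[OF m' d']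
          galois_lift_pure[OF A.mult_bilinear coact_linear] A'(2))
  qed
qed

text \<open>Since components of coinvariants are coinvariant, the relations of the balanced tensor product
  are sums of relations between homogeneous elements.\<close>

lemma balancing_homogeneous:
  assumes m: "cbilinear \<mu>" and b: "b \<in> coinvariants H A"
    and sub: "csubspace N"
    and hom: "\<And>p q r p' q' x b y. x \<in> AG (p, q) \<Longrightarrow> b \<in> AG (r, 0) \<Longrightarrow> b \<in> coinvariants H A \<Longrightarrow>
      y \<in> AG (p', q') \<Longrightarrow> \<mu> x b \<otimes> y - x \<otimes> \<mu> b y \<in> N"
  shows "\<mu> x b \<otimes> y - x \<otimes> \<mu> b y \<in> N"
proof -
  let ?c = "components AG" and ?p = "Poly_Mapping.lookup"
  note tl = cbilinearD(1)[OF tensor_bilinear] and tr = cbilinearD(2)[OF tensor_bilinear]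
  note l = cbilinearD(1)[OF m] and r = cbilinearD(2)[OF m]
  have eq: "\<mu> x b \<otimes> y - x \<otimes> \<mu> b y =
     (\<Sum>e\<in>Poly_Mapping.keys (?c y). \<Sum>f\<in>Poly_Mapping.keys (?c b). \<Sum>d\<in>Poly_Mapping.keys (?c x).
       \<mu> (?p (?c x) d) (?p (?c b) f) \<otimes> ?p (?c y) e - ?p (?c x) d \<otimes> \<mu> (?p (?c b) f) (?p (?c y) e))"
  proof -
    let ?X = "\<Sum>d\<in>Poly_Mapping.keys (?c x). ?p (?c x) d"
    let ?B = "\<Sum>d\<in>Poly_Mapping.keys (?c b). ?p (?c b) d"
    let ?Y = "\<Sum>d\<in>Poly_Mapping.keys (?c y). ?p (?c y) d"
    have "\<mu> x b \<otimes> y - x \<otimes> \<mu> b y = \<mu> ?X ?B \<otimes> ?Y - ?X \<otimes> \<mu> ?B ?Y"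
      by (simp only: components_sum[OF comodule_graded])
    then show ?thesis
      by (simp only: clinear_sum[OF l] clinear_sum[OF r] clinear_sum[OF tl] clinear_sum[OF tr]
          sum_subtractf)
  qed
  have "\<mu> (?p (?c x) d) (?p (?c b) f) \<otimes> ?p (?c y) e - ?p (?c x) d \<otimes> \<mu> (?p (?c b) f) (?p (?c y) e) \<in> N"
    if f: "f \<in> Poly_Mapping.keys (?c b)" for d e f
  proof -
    obtain p q p' q' r' where "d = (p, q)" "e = (p', q')" "f = (r', 0)"
      using f coinvariant_component(1)[OF b] by (cases d; cases e; cases f) (auto simp: in_keys_iff)
    then show ?thesis
      using hom components_homogeneous[OF comodule_graded] coinvariant_component(2)[OF b] by metis
  qed
  then show ?thesis
    unfolding eq by (intro complex_vector.subspace_sum[OF sub])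
qed

text \<open>On homogeneous \<open>a\<close>, \<open>b\<close>, \<open>m\<close> of degrees \<open>(p, q)\<close>, \<open>(r, 0)\<close>, \<open>(p', q')\<close> the conditions on the
  factor \<open>k\<close> say that both terms of the original relation acquire, up to the common
  factor \<open>k\<close>, the weights that the new product gives them.\<close>

lemma rescale_galois_relations:
  assumes A': "alg_mult A' = twist AG AG m (alg_mult A)" "coinvariants H' A' = coinvariants H A"
    and k: "\<And>p r p'. k p r p' \<noteq> 0"
      "\<And>p q r p' q'. k p r p' * c (p + r, q) (p', q') = m (p, q) (r, 0)"
      "\<And>p q r p' q'. k p r p' * c (p, q) (r + p', q') = m (r, 0) (p', q')"
  shows "galois_relations H' A' = rescale AG AG c ` galois_relations H A"
proof -
  let ?R = "rescale AG AG c" and ?N = "galois_relations H A" and ?N' = "galois_relations H' A'"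
  note R = clinear_rescale[OF AA, of c] and m = A.mult_bilinear
  note tl = cbilinearD(1)[OF tensor_bilinear] and tr = cbilinearD(2)[OF tensor_bilinear]
  have m': "cbilinear (alg_mult A')"
    unfolding A' by (rule cbilinear_twist[OF AA m])
  have subN: "csubspace ?N" and subN': "csubspace ?N'"
    by (simp_all add: balancing_def)
  have subI: "csubspace (?R ` ?N)"
    by (rule module_hom.subspace_image[OF R[unfolded Vector_Spaces.linear_iff_module_hom] subN])
  have subV: "csubspace (?R -` ?N')"
    by (rule module_hom.subspace_vimage[OF R[unfolded Vector_Spaces.linear_iff_module_hom] subN'])
  have gen: "alg_mult A' x b \<otimes> y - x \<otimes> alg_mult A' b y =
      k p r p' *\<^sub>C ?R (alg_mult A x b \<otimes> y - x \<otimes> alg_mult A b y)"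
    if x: "x \<in> AG (p, q)" and b: "b \<in> AG (r, 0)" and y: "y \<in> AG (p', q')" for p q r p' q' x b y
  proof -
    have xb: "alg_mult A x b \<in> AG (p + r, q)" and by_: "alg_mult A b y \<in> AG (r + p', q')"
      using comodule_graded_mult x b y unfolding graded_mult_def by fastforce+
    show ?thesis
      by (simp add: A'(1) twist_homogeneous[OF AA m x b] twist_homogeneous[OF AA m b y]
          clinear_diff[OF R] rescale_homogeneous[OF AA xb y] rescale_homogeneous[OF AA x by_]
          clinear_scale[OF tl] clinear_scale[OF tr] complex_vector.scale_right_diff_distrib
          scaleC_scaleC k(2) k(3)[where q = q])
  qed
  have "?N' \<subseteq> ?R ` ?N"
    unfolding galois_relations_eq[of A' H'] unfolding A'(2)
  proof (rule complex_vector.span_minimal[OF _ subI], safe)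
    fix x b y assume "b \<in> coinvariants H A"
    then show "alg_mult A' x b \<otimes> y - x \<otimes> alg_mult A' b y \<in> ?R ` ?N"
    proof (rule balancing_homogeneous[OF m' _ subI])
      fix p q r p' q' x b y
      assume h: "x \<in> AG (p, q)" "b \<in> AG (r, 0)" "y \<in> AG (p', q')" and b: "b \<in> coinvariants H A"
      have "alg_mult A x b \<otimes> y - x \<otimes> alg_mult A b y \<in> ?N"
        unfolding galois_relations_eq by (rule complex_vector.span_base) (use b in blast)
      then show "alg_mult A' x b \<otimes> y - x \<otimes> alg_mult A' b y \<in> ?R ` ?N"
        unfolding gen[OF h] by (intro complex_vector.subspace_scale[OF subI] imageI)
    qed
  qed
  moreover have "?N \<subseteq> ?R -` ?N'"
    unfolding galois_relations_eq[of A H]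
  proof (rule complex_vector.span_minimal[OF _ subV], safe)
    fix x b y assume "b \<in> coinvariants H A"
    then show "alg_mult A x b \<otimes> y - x \<otimes> alg_mult A b y \<in> ?R -` ?N'"
    proof (rule balancing_homogeneous[OF m _ subV])
      fix p q r p' q' x b y
      assume h: "x \<in> AG (p, q)" "b \<in> AG (r, 0)" "y \<in> AG (p', q')" and b: "b \<in> coinvariants H A"
      have "alg_mult A' x b \<otimes> y - x \<otimes> alg_mult A' b y \<in> ?N'"
        unfolding galois_relations_eq by (rule complex_vector.span_base) (use b A'(2) in blast)
      from complex_vector.subspace_scale[OF subN' this, of "inverse (k p r p')"]
      show "alg_mult A x b \<otimes> y - x \<otimes> alg_mult A b y \<in> ?R -` ?N'"
        unfolding gen[OF h] by (simp add: scaleC_scaleC k(1) scaleC_one)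
    qed
  qed
  ultimately show ?thesis by blast
qed

end


section \<open>The deformation phases\<close>

lemma deform_phase_add_left: "deform_phase \<theta> (r + r') l = deform_phase \<theta> r l * deform_phase \<theta> r' l"
proof -
  have "(\<chi> i. real_of_int ((r + r') $ i)) = (\<chi> i. real_of_int (r $ i)) + (\<chi> i. real_of_int (r' $ i))"
    by (simp add: vec_eq_iff)
  then show ?thesis
    by (simp add: deform_phase_def matrix_vector_right_distrib inner_add_left
        flip: exp_add) (simp add: algebra_simps)
qed

lemma deform_phase_add_right: "deform_phase \<theta> r (l + l') = deform_phase \<theta> r l * deform_phase \<theta> r l'"
proof -
  have "(\<chi> i. real_of_int ((l + l') $ i)) = (\<chi> i. real_of_int (l $ i)) + (\<chi> i. real_of_int (l' $ i))"
    by (simp add: vec_eq_iff)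
  then show ?thesis
    by (simp add: deform_phase_def inner_add_right flip: exp_add) (simp add: algebra_simps)
qed

lemma deform_phase_neg: "deform_phase (- \<theta>) r l * deform_phase \<theta> r l = 1"
proof -
  have "(- \<theta>) *v v = - (\<theta> *v v)" for v :: "real ^ 'a"
    by (simp add: matrix_vector_mult_def vec_eq_iff sum_negf)
  then show ?thesis
    by (simp add: deform_phase_def flip: exp_add)
qed

lemma deform_phase_nonzero: "deform_phase \<theta> r l \<noteq> 0"
  by (simp add: deform_phase_def)

lemma deform_phase_zero: "deform_phase \<theta> r 0 = 1" "deform_phase \<theta> 0 l = 1"
  using deform_phase_add_right[of \<theta> r 0 0] deform_phase_add_left[of \<theta> 0 0 l]
  by (simp_all add: deform_phase_nonzero)

lemma deform_phase_skew:
  assumes "transpose \<theta> = - \<theta>"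
  shows "deform_phase \<theta> r r = 1"
proof -
  let ?v = "(\<chi> i. real_of_int (r $ i)) :: real ^ 'a"
  have "(\<theta> *v ?v) \<bullet> ?v = ?v \<bullet> (transpose \<theta> *v ?v)"
    by (metis dot_lmul_matrix transpose_matrix_vector inner_commute transpose_transpose)
  also have "\<dots> = - ((\<theta> *v ?v) \<bullet> ?v)"
    unfolding assms by (simp add: matrix_vector_mult_def inner_vec_def sum_negf mult.commute)
  finally have "(\<theta> *v ?v) \<bullet> ?v = 0" by simp
  then show ?thesis by (simp add: deform_phase_def)
qed

lemma deform_phase_skew_neg:
  assumes "transpose \<theta> = - \<theta>"
  shows "deform_phase (- \<theta>) r r = 1"
  using deform_phase_neg[of \<theta> r r] deform_phase_skew[OF assms] by simp


section \<open>Tensors of total first degree zero\<close>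

lemma rescale_first_degree_zero:
  assumes G: "bigrading G" and c: "\<And>p r s. c (- p, r) (p, s) = 1" and t: "t \<in> first_degree_zero G"
  shows "rescale G G c t = t"
proof -
  note R = clinear_rescale[OF G G, of c]
  have "csubspace {t. rescale G G c t = t}"
    unfolding complex_vector.subspace_def
    by (simp add: clinear_zero[OF R] clinear_add[OF R] clinear_scale[OF R])
  with t[unfolded first_degree_zero_def] show ?thesis
    by (rule complex_vector.span_induct) (auto simp: rescale_homogeneous[OF G G] c scaleC_one)
qed

lemma rescale_into_first_degree_zero:
  fixes G :: "'n::finite bidegree \<Rightarrow> 'v::complex_vector set"
  assumes G: "bigrading G" and c: "\<And>d e. fst d + fst e \<noteq> 0 \<Longrightarrow> c d e = 0"
  shows "rescale G G c t \<in> first_degree_zero G"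
proof -
  note R = clinear_rescale[OF G G, of c]
  let ?F = "first_degree_zero G"
  have subF: "csubspace ?F"
    by (simp add: first_degree_zero_def)
  then have "csubspace {t. rescale G G c t \<in> ?F}"
    unfolding complex_vector.subspace_def
    by (simp add: clinear_zero[OF R] clinear_add[OF R] clinear_scale[OF R])
  with tensor_span show ?thesis
  proof (rule complex_vector.span_induct)
    fix u :: "('v, 'v) tensor"
    assume "u \<in> {x \<otimes> y |x y. True}"
    then obtain x y where u: "u = x \<otimes> y" by blast
    have "c d e *\<^sub>C (Poly_Mapping.lookup (components G x) d \<otimes> Poly_Mapping.lookup (components G y) e) \<in> ?F"
      for d e
    proof (cases "fst d + fst e = 0")
      case True
      then have "d = (- fst e, snd d)" "e = (fst e, snd e)"
        by (simp_all add: prod_eq_iff eq_neg_iff_add_eq_0)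
      then have "Poly_Mapping.lookup (components G x) d \<otimes> Poly_Mapping.lookup (components G y) e \<in> ?F"
        unfolding first_degree_zero_def using components_homogeneous[OF G]
        by (intro complex_vector.span_base) (metis (mono_tags, lifting) mem_Collect_eq)
      then show ?thesis by (rule complex_vector.subspace_scale[OF subF])
    qed (simp add: c complex_vector.subspace_0[OF subF])
    then show "rescale G G c u \<in> ?F"
      unfolding u tensor_lift_tensor[OF cbilinear_twist[OF G G tensor_bilinear]] twist_def
      by (intro complex_vector.subspace_sum[OF subF])
  qed
qed


section \<open>The deformed Galois map\<close>

lemma alg_mult_deform:
  "alg_mult (deform \<theta> G X) =
    twist G G (\<lambda>d e. deform_phase \<theta> (fst d) (fst e) * deform_phase (- \<theta>) (snd d) (snd e)) (alg_mult X)"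
  by (intro ext) (simp add: deform_def twist_def case_prod_beta)

lemma coinvariants_deform:
  "coinvariants (deform \<theta> HG H) (deform \<theta> AG A) = coinvariants H A"
  by (simp add: coinvariants_def deform_def)

context graded_extension
begin

text \<open>Skew-symmetry enters through \<open>\<lambda>\<^sub>-\<^sub>\<theta>(s, s) = 1\<close>: the second degree of \<open>x y\<^sub>0\<close> is \<open>q + s\<close>, whereas the
  deformed product only sees \<open>\<lambda>\<^sub>-\<^sub>\<theta>(q, s)\<close>.\<close>

lemma galois_lift_deform:
  assumes "transpose \<theta> = - \<theta>"
  shows "galois_lift (deform \<theta> AG A) (rescale AG AG (\<lambda>d e. deform_phase (- \<theta>) (fst d) (fst e)) t) =
    rescale AG HG (\<lambda>d e. deform_phase (- \<theta>) (snd d) (fst e)) (galois_lift A t)"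
proof (rule rescale_galois_lift[OF alg_mult_deform])
  show "coact (deform \<theta> AG A) = coact A"
    by (simp add: deform_def)
qed (use deform_phase_neg[of \<theta>] in
      \<open>simp add: deform_phase_add_left deform_phase_skew_neg[OF assms] ac_simps\<close>)

lemma galois_relations_deform:
  "galois_relations (deform \<theta> HG H) (deform \<theta> AG A) =
    rescale AG AG (\<lambda>d e. deform_phase (- \<theta>) (fst d) (fst e)) ` galois_relations H A"
proof (rule rescale_galois_relations[OF alg_mult_deform coinvariants_deform])
  \<comment> \<open>The product of the phases of all three pairs among \<open>a\<close>, \<open>b\<close>, \<open>m\<close>: multiplied by
    \<open>\<lambda>\<^sub>-\<^sub>\<theta>(p + r, p')\<close> it leaves the pair \<open>a\<close>, \<open>b\<close>, multiplied by \<open>\<lambda>\<^sub>-\<^sub>\<theta>(p, r + p')\<close> the pair \<open>b\<close>, \<open>m\<close>.\<close>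
  let ?k = "\<lambda>p r p'. deform_phase \<theta> p p' * deform_phase \<theta> p r * deform_phase \<theta> r p'"
  show "?k p r p' \<noteq> 0" for p r p'
    by (simp add: deform_phase_nonzero)
  have inv: "deform_phase (- \<theta>) a b = inverse (deform_phase \<theta> a b)" for a b
    using deform_phase_neg[of \<theta> a b] by (metis inverse_unique mult.commute)
  show "?k p r p' * deform_phase (- \<theta>) (fst (p + r, q)) (fst (p', q')) =
      deform_phase \<theta> (fst (p, q)) (fst (r, 0)) * deform_phase (- \<theta>) (snd (p, q)) (snd (r, 0))"
    for p q r p' q' :: "int ^ 'n"
    by (simp add: inv deform_phase_add_left deform_phase_zero deform_phase_nonzero field_simps)
  show "?k p r p' * deform_phase (- \<theta>) (fst (p, q)) (fst (r + p', q')) =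
      deform_phase \<theta> (fst (r, 0)) (fst (p', q')) * deform_phase (- \<theta>) (snd (r, 0)) (snd (p', q'))"
    for p q r p' q' :: "int ^ 'n"
    by (simp add: inv deform_phase_add_right deform_phase_zero deform_phase_nonzero field_simps)
qed

text \<open>Projecting any representative onto total first degree zero works, because the lifted Galois map turns this
  projection into the one of \<open>A \<otimes> H\<close> onto first degree zero of \<open>A\<close>, which fixes \<open>1 \<otimes> h\<close>.\<close>

lemma translation_representative:
  assumes "galois_lift A t = alg_one A \<otimes> h"
  shows "\<exists>u \<in> first_degree_zero AG. galois_lift A u = alg_one A \<otimes> h"
proof -
  define c where "c d e = (if fst d + fst e = 0 then 1 else 0 :: complex)" for d e :: "'n bidegree"
  define c' where "c' d e = (if fst d = 0 then 1 else 0 :: complex)" for d e :: "'n bidegree"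
  note tr = cbilinearD(2)[OF tensor_bilinear]
  have "galois_lift A (rescale AG AG c t) = rescale AG HG c' (galois_lift A t)"
    by (rule rescale_galois_lift[OF twist_one[OF AA A.mult_bilinear, symmetric]])
      (simp_all add: c_def c'_def)
  also have "\<dots> = alg_one A \<otimes> h"
    unfolding assms
    by (rule clinear_eq_graded[OF hopf_graded clinear_comp[OF clinear_rescale[OF AH] tr] tr])
      (simp add: rescale_homogeneous[OF AH unit_degree] c'_def scaleC_one)
  finally show ?thesis
    using rescale_into_first_degree_zero[OF comodule_graded, of c] by (auto simp: c_def)
qed

lemma galois_deformation:
  assumes skew: "transpose \<theta> = - \<theta>"
  shows "galois_invertible (deform \<theta> HG H) (deform \<theta> AG A) \<longleftrightarrow> galois_invertible H A"
    and "galois_invertible H A \<Longrightarrow>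
      same_translation_map AG (translation_map H A)
        (translation_map (deform \<theta> HG H) (deform \<theta> AG A))"
proof -
  let ?H = "deform \<theta> HG H" and ?A = "deform \<theta> AG A"
  let ?\<phi> = "rescale AG AG (\<lambda>d e. deform_phase (- \<theta>) (fst d) (fst e))"
  let ?\<psi> = "rescale AG HG (\<lambda>d e. deform_phase (- \<theta>) (snd d) (fst e))"
  let ?G = "galois_lift A" and ?G' = "galois_lift ?A"
  have L: "clinear ?G"
    by (rule clinear_galois_lift[OF A.mult_bilinear coact_linear])
  have "cbilinear (alg_mult ?A)"
    unfolding alg_mult_deform by (rule cbilinear_twist[OF AA A.mult_bilinear])
  then have L': "clinear ?G'"
    by (rule clinear_galois_lift) (simp add: deform_def coact_linear)
  have "galois_relations H A \<subseteq> {u. ?G u = 0}"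
    unfolding galois_relations_eq
  proof (rule complex_vector.span_minimal)
    show "csubspace {u. ?G u = 0}"
      by (rule module_hom.subspace_kernel[OF L[unfolded Vector_Spaces.linear_iff_module_hom]])
    show "{alg_mult A a b \<otimes> m - a \<otimes> alg_mult A b m |a b m. b \<in> coinvariants H A} \<subseteq> {u. ?G u = 0}"
      using galois_lift_balanced by (auto simp: clinear_diff[OF L])
  qed
  then have null: "?G u = 0" if "u \<in> galois_relations H A" for u
    using that by blast
  have com: "?G' (?\<phi> t) = ?\<psi> (?G t)" for t
    by (rule galois_lift_deform[OF skew])
  have \<phi>: "bij ?\<phi>" and \<psi>: "bij ?\<psi>"
    by (intro bij_rescale AA AH deform_phase_nonzero)+
  have \<psi>0: "?\<psi> s = 0 \<longleftrightarrow> s = 0" for s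
    using inj_eq[OF bij_is_inj[OF \<psi>], of s 0] by (simp add: clinear_zero[OF clinear_rescale[OF AH]])
  have N: "?\<phi> t \<in> galois_relations ?H ?A \<longleftrightarrow> t \<in> galois_relations H A" for t
    unfolding galois_relations_deform using bij_is_inj[OF \<phi>] by (rule inj_image_mem_iff)
  have null': "?G' u = 0" if "u \<in> galois_relations ?H ?A" for u
    using that unfolding galois_relations_deform by (auto simp: com null \<psi>0)
  have "surj ?G' \<longleftrightarrow> surj ?G"
  proof -
    have "range ?G' = ?\<psi> ` range ?G"
    proof -
      have "range ?G' = range (\<lambda>t. ?G' (?\<phi> t))"
        using bij_is_surj[OF \<phi>] by (simp add: image_image[symmetric])
      then show ?thesis
        by (simp only: com image_image)
    qed
    moreover have "?\<psi> ` X = UNIV \<longleftrightarrow> X = UNIV" for X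
      using inj_image_eq_iff[OF bij_is_inj[OF \<psi>], of X UNIV] bij_is_surj[OF \<psi>] by simp
    ultimately show ?thesis
      by simp
  qed
  moreover have "(\<forall>u. ?G' u = 0 \<longrightarrow> u \<in> galois_relations ?H ?A) \<longleftrightarrow>
      (\<forall>t. ?G t = 0 \<longrightarrow> t \<in> galois_relations H A)"
  proof -
    have "(\<forall>u. ?G' u = 0 \<longrightarrow> u \<in> galois_relations ?H ?A) \<longleftrightarrow>
        (\<forall>u\<in>range ?\<phi>. ?G' u = 0 \<longrightarrow> u \<in> galois_relations ?H ?A)"
      by (simp only: bij_is_surj[OF \<phi>] ball_UNIV)
    then show ?thesis
      by (simp only: ball_simps com \<psi>0 N)
  qed
  ultimately show iff: "galois_invertible ?H ?A \<longleftrightarrow> galois_invertible H A"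
    by (simp add: galois_invertible_iff[OF L null] galois_invertible_iff[OF L' null'])
  assume inv: "galois_invertible H A"
  note fib = translation_map_fibre[OF L null inv]
    and fib' = translation_map_fibre[OF L' null' iff[THEN iffD2, OF inv]]
  show "same_translation_map AG (translation_map H A) (translation_map ?H ?A)"
    unfolding same_translation_map_def
  proof (intro allI conjI)
    fix h
    note tr = cbilinearD(2)[OF tensor_bilinear]
    have one: "?\<psi> (alg_one A \<otimes> h) = alg_one A \<otimes> h"
      by (rule clinear_eq_graded[OF hopf_graded clinear_comp[OF clinear_rescale[OF AH] tr] tr])
        (simp add: rescale_homogeneous[OF AH unit_degree] deform_phase_zero scaleC_one)
    have "?G' t = alg_one A \<otimes> h \<longleftrightarrow> ?G t = alg_one A \<otimes> h" if "t \<in> first_degree_zero AG" for t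
    proof -
      have neg: "deform_phase (- \<theta>) (- p) p = 1" for p
        using deform_phase_add_left[of "- \<theta>" "- p" p p]
        by (simp add: deform_phase_zero deform_phase_skew_neg[OF skew])
      have "?\<phi> t = t"
        by (rule rescale_first_degree_zero[OF comodule_graded _ that]) (simp add: neg)
      then have "?G' t = ?\<psi> (?G t)"
        using com[of t] by simp
      then show ?thesis
        using inj_eq[OF bij_is_inj[OF \<psi>], of "?G t" "alg_one A \<otimes> h"] by (simp add: one)
    qed
    moreover have "alg_one ?A = alg_one A"
      by (simp add: deform_def)
    ultimately show "translation_map H A h \<inter> first_degree_zero AG =
        translation_map ?H ?A h \<inter> first_degree_zero AG"
      by (auto simp: fib fib')
    have "surj ?G"
      using inv by (simp add: galois_invertible_iff[OF L null])
    then obtain t where "alg_one A \<otimes> h = ?G t"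
      by (elim surjE)
    from translation_representative[OF this[symmetric]] show "translation_map H A h \<inter> first_degree_zero AG \<noteq> {}"
      by (auto simp: fib)
  qed
qed

end

theorem proposition4p14:
  fixes H :: "'h::complex_vector hopf_alg"
    and star :: "('h \<Rightarrow> 'h) option"
    and HG :: "'n::finite bidegree \<Rightarrow> 'h set"
    and A :: "('a::complex_vector, 'h) comod_alg"
    and AG :: "'n bidegree \<Rightarrow> 'a set"
    and \<theta> :: "real ^ 'n ^ 'n"
  assumes "hopf_algebra H"
    and "comodule_algebra H A"
    and "faithfully_flat TYPE(nat \<Rightarrow>\<^sub>0 'a) A (coinvariants H A)"
    and "hopf_bigrading H star HG"
    and "comodule_bigrading HG A AG"
    and "transpose \<theta> = - \<theta>"
  shows "(galois_invertible (deform \<theta> HG H) (deform \<theta> AG A) \<longleftrightarrow> galois_invertible H A) \<and>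
    (galois_invertible H A \<longrightarrow>
      same_translation_map AG (translation_map H A)
        (translation_map (deform \<theta> HG H) (deform \<theta> AG A)))"
proof -
  interpret graded_extension H A HG AG
    using assms(2,4,5)
    by (intro graded_extension.intro graded_extension_axioms.intro)
      (auto simp: hopf_bigrading_def)
  show ?thesis
    using galois_deformation[OF assms(6)] by blast
qed

end
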